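(* Let $L\subseteq\overline{\mathbb{Q}}$ be a field. If $A\subseteq L$ is existentially definable in $L$, then $A$ is definable in $L$ by a formula of the form $$\alpha(X)=\bigvee_{i=1}^r\beta_i(X),$$ where each $\beta_i(X)$ has one of the following forms: (i) the quantifier-free formula $X=z_0$ for a fixed $z_0\in L$; (ii) a formula of the form $$\exists Y_1\cdots\exists Y_e\,[\,f(X,Y_1,\dots,Y_e)=0\neq g(X,Y_1,\dots,Y_e)\,]$$ for polynomials $f,g\in L[X,Y_1,\dots,Y_e]$, where $f$ is absolutely irreducible (irreducible over $\overline{\mathbb{Q}}$) and does not divide $g$.
   Context: $\overline{\mathbb{Q}}$ is a fixed algebraic closure of $\mathbb{Q}$. A subset $A\subseteq L$ is existentially definable in $L$ if it is the set of $x\in L$ satisfying in $L$ a formula $\exists\vec Y\,\phi(X,\vec Y)$, where $\phi$ is a quantifier-free formula in the language of rings with parameters from $L$. The empty disjunction ($r=0$, defining $\emptyset$) is allowed. The number $e$ of quantified variables may depend on $i$. *)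

theory Defs
  imports "HOL-Algebra.Algebraic_Closure_Type" "HOL-Algebra.Ring_Divisibility"
    "HOL-Library.Poly_Mapping" "HOL-Library.FuncSet"
begin

section \<open>Quantifier-free formulas in the language of rings with parameters\<close>

datatype (params_term: 'a) rterm =
    TVar nat
  | TParam 'a
  | TZero
  | TOne
  | TNeg "'a rterm"
  | TAdd "'a rterm" "'a rterm"
  | TMul "'a rterm" "'a rterm"

datatype (params: 'a) qf_formula =
    FEq "'a rterm" "'a rterm"
  | FNot "'a qf_formula"
  | FAnd "'a qf_formula" "'a qf_formula"
  | FOr "'a qf_formula" "'a qf_formula"

primrec vars_term :: "'a rterm \<Rightarrow> nat set" where
  "vars_term (TVar i) = {i}"
| "vars_term (TParam a) = {}"
| "vars_term TZero = {}"
| "vars_term TOne = {}"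
| "vars_term (TNeg s) = vars_term s"
| "vars_term (TAdd s t) = vars_term s \<union> vars_term t"
| "vars_term (TMul s t) = vars_term s \<union> vars_term t"

primrec vars :: "'a qf_formula \<Rightarrow> nat set" where
  "vars (FEq s t) = vars_term s \<union> vars_term t"
| "vars (FNot \<phi>) = vars \<phi>"
| "vars (FAnd \<phi> \<psi>) = vars \<phi> \<union> vars \<psi>"
| "vars (FOr \<phi> \<psi>) = vars \<phi> \<union> vars \<psi>"

primrec val :: "(nat \<Rightarrow> 'a::comm_ring_1) \<Rightarrow> 'a rterm \<Rightarrow> 'a" where
  "val v (TVar i) = v i"
| "val v (TParam a) = a"
| "val v TZero = 0"
| "val v TOne = 1"
| "val v (TNeg s) = - val v s"
| "val v (TAdd s t) = val v s + val v t"
| "val v (TMul s t) = val v s * val v t"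

primrec sat :: "(nat \<Rightarrow> 'a::comm_ring_1) \<Rightarrow> 'a qf_formula \<Rightarrow> bool" where
  "sat v (FEq s t) \<longleftrightarrow> val v s = val v t"
| "sat v (FNot \<phi>) \<longleftrightarrow> \<not> sat v \<phi>"
| "sat v (FAnd \<phi> \<psi>) \<longleftrightarrow> sat v \<phi> \<and> sat v \<psi>"
| "sat v (FOr \<phi> \<psi>) \<longleftrightarrow> sat v \<phi> \<or> sat v \<psi>"

text \<open>
  Here and below \<open>L\<close> is a subfield of the ambient field \<open>'a\<close>. Variable \<open>0\<close> is \<open>X\<close> and
  variable \<open>i + 1\<close> is \<open>Y\<^sub>i\<^sub>+\<^sub>1\<close>, so \<open>case_nat x y\<close> is the assignment \<open>X \<mapsto> x\<close>,
  \<open>Y\<^sub>i\<^sub>+\<^sub>1 \<mapsto> y i\<close>; of \<open>y\<close> only the values \<open>y 0, \<dots>, y (e - 1)\<close> matter. As \<open>L\<close> is closed under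
  the ring operations, evaluating terms in \<open>'a\<close> at points of \<open>L\<close> is evaluating them in \<open>L\<close>.
\<close>

definition existentially_definable :: "'a::comm_ring_1 set \<Rightarrow> 'a set \<Rightarrow> bool" where
  "existentially_definable L A \<longleftrightarrow>
     (\<exists>e \<phi>. params \<phi> \<subseteq> L \<and> vars \<phi> \<subseteq> {..e} \<and>
            A = {x \<in> L. \<exists>y \<in> {..<e} \<rightarrow> L. sat (case_nat x y) \<phi>})"


section \<open>Multivariate polynomials\<close>

text \<open>A polynomial maps exponent vectors (finitely supported functions from variable indices
  to exponents) to coefficients; the product on \<open>\<Rightarrow>\<^sub>0\<close> is convolution.\<close>

type_synonym 'a mpoly = "(nat \<Rightarrow>\<^sub>0 nat) \<Rightarrow>\<^sub>0 'a"

definition eval_mpoly :: "(nat \<Rightarrow> 'a::comm_ring_1) \<Rightarrow> 'a mpoly \<Rightarrow> 'a" where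
  "eval_mpoly v p =
     (\<Sum>m \<in> Poly_Mapping.keys p. Poly_Mapping.lookup p m *
        (\<Prod>i \<in> Poly_Mapping.keys m. v i ^ Poly_Mapping.lookup m i))"

text \<open>The ring \<open>K[X, Y\<^sub>1, \<dots>, Y\<^sub>e]\<close>, in the \<open>e + 1\<close> variables with indices \<open>0, \<dots>, e\<close>.\<close>

definition mpoly_ring :: "'a::comm_ring_1 set \<Rightarrow> nat \<Rightarrow> 'a mpoly ring" where
  "mpoly_ring K e = ring_of_type_algebra
     \<lparr>carrier := {p. (\<forall>m. Poly_Mapping.lookup p m \<in> K) \<and>
                     (\<forall>m \<in> Poly_Mapping.keys p. Poly_Mapping.keys m \<subseteq> {..e})}\<rparr>"

text \<open>Irreducibility in \<open>'a[X, Y\<^sub>1, \<dots>, Y\<^sub>e]\<close>; this is absolute irreducibility because it is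
  only used with \<open>'a\<close> the algebraic closure of the rationals.\<close>

definition absolutely_irreducible :: "nat \<Rightarrow> 'a::alg_closed_field mpoly \<Rightarrow> bool" where
  "absolutely_irreducible e f \<longleftrightarrow> ring_irreducible\<^bsub>mpoly_ring UNIV e\<^esub> f"


section \<open>The disjuncts of the normal form\<close>

text \<open>\<open>Point z\<close> stands for \<open>X = z\<close>, and \<open>Hypersurface e f g\<close> for
  \<open>\<exists>Y\<^sub>1 \<dots> Y\<^sub>e. f(X, Y\<^sub>1, \<dots>, Y\<^sub>e) = 0 \<noteq> g(X, Y\<^sub>1, \<dots>, Y\<^sub>e)\<close>.\<close>

context notes [[typedef_overloaded]] begin

datatype 'a basic_formula =
    Point 'a
  | Hypersurface nat "'a mpoly" "'a mpoly"

end

primrec admissible :: "'a::alg_closed_field set \<Rightarrow> 'a basic_formula \<Rightarrow> bool" where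
  "admissible L (Point z) \<longleftrightarrow> z \<in> L"
| "admissible L (Hypersurface e f g) \<longleftrightarrow>
     f \<in> carrier (mpoly_ring L e) \<and> g \<in> carrier (mpoly_ring L e) \<and>
     absolutely_irreducible e f \<and> \<not> f divides\<^bsub>mpoly_ring L e\<^esub> g"

primrec sat_basic :: "'a::comm_ring_1 set \<Rightarrow> 'a \<Rightarrow> 'a basic_formula \<Rightarrow> bool" where
  "sat_basic L x (Point z) \<longleftrightarrow> x = z"
| "sat_basic L x (Hypersurface e f g) \<longleftrightarrow>
     (\<exists>y \<in> {..<e} \<rightarrow> L. eval_mpoly (case_nat x y) f = 0 \<and> eval_mpoly (case_nat x y) g \<noteq> 0)"

end

theory Submission
  imports Defs
begin

text \<open>
  Suppose that \<open>A\<close> is not a finite union of sets defined by admissible formulas. Let \<open>F\<close> be an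
  ultrapower of the algebraic closure of the rationals, indexed by sets of formulas, whose
  ultrafilter contains for every formula \<open>\<beta>\<close> the family of finite sets having \<open>\<beta>\<close> as a member.
  Choosing for each finite set of formulas a point of \<open>A\<close> outside the admissible subsets of \<open>A\<close>
  that they define gives \<open>x \<in> F\<close>, which lies in the extension of \<open>A\<close> but in the extension of no
  admissible subset of \<open>A\<close>. If \<open>x\<close> were algebraic, it would be an element of \<open>L\<close>, and \<open>X = x\<close>
  would define such a subset; so \<open>x\<close> is transcendental.

  Choose witnesses \<open>y\<close> for \<open>x\<close> and a shortest tuple \<open>w\<close> of classes of \<open>L\<close>-valued functions with
  \<open>y \<in> L(x, w)\<close>. By the primitive element theorem all coordinates of \<open>w\<close> but at most one are
  algebraically independent over \<open>L(x)\<close>. The polynomials vanishing at \<open>(x, w)\<close> form a prime ideal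
  that is spanned by polynomials over \<open>L\<close>. An element \<open>f\<close> of minimal degree is therefore absolutely
  irreducible, and by pseudo-division it generates the ideal after inverting an element that does
  not vanish at \<open>(x, w)\<close>. Hence, for a suitable \<open>g\<close>, the condition \<open>f = 0 \<noteq> g\<close> forces all atomic
  formulas to have the same truth values as at \<open>(x, y)\<close>, and it defines an admissible subset of
  \<open>A\<close> whose extension contains \<open>x\<close>, a contradiction.
\<close>

section \<open>Polynomials and their values\<close>

abbreviation lookup where "lookup \<equiv> Poly_Mapping.lookup"
abbreviation keys where "keys \<equiv> Poly_Mapping.keys"

lemma poly_mapping_as_sum: "p = (\<Sum>m\<in>keys p. Poly_Mapping.single m (lookup p m))"
  by (rule poly_mapping_eqI)
    (simp add: lookup_sum lookup_single when_def in_keys_iff)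

lemma poly_mapping_mult_as_sum:
  fixes p q :: "'b::monoid_add \<Rightarrow>\<^sub>0 'a::semiring_0"
  shows "p * q = (\<Sum>m\<in>keys p. \<Sum>n\<in>keys q. Poly_Mapping.single (m + n) (lookup p m * lookup q n))"
proof -
  have "p * q = (\<Sum>m\<in>keys p. Poly_Mapping.single m (lookup p m)) * (\<Sum>n\<in>keys q. Poly_Mapping.single n (lookup q n))"
    using poly_mapping_as_sum[of p] poly_mapping_as_sum[of q] by simp
  thus ?thesis by (simp add: sum_product mult_single)
qed

section \<open>Subfields as sets, and polynomials over them\<close>

text \<open>Because \<open>inverse 0 = 0\<close>, closure under \<open>inverse\<close> needs no
  exception for zero.\<close>

definition subfield_set :: "'a::field set \<Rightarrow> bool" where
  "subfield_set K \<longleftrightarrow> 0 \<in> K \<and> 1 \<in> K \<and> (\<forall>a\<in>K. \<forall>b\<in>K. a + b \<in> K \<and> a * b \<in> K) \<and>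
     (\<forall>a\<in>K. - a \<in> K \<and> inverse a \<in> K)"

lemma subfield_setD:
  assumes "subfield_set K"
  shows "0 \<in> K" "1 \<in> K" "a \<in> K \<Longrightarrow> b \<in> K \<Longrightarrow> a + b \<in> K" "a \<in> K \<Longrightarrow> b \<in> K \<Longrightarrow> a * b \<in> K"
    "a \<in> K \<Longrightarrow> - a \<in> K" "a \<in> K \<Longrightarrow> inverse a \<in> K" "a \<in> K \<Longrightarrow> b \<in> K \<Longrightarrow> a - b \<in> K"
    "a \<in> K \<Longrightarrow> b \<in> K \<Longrightarrow> a / b \<in> K"
  using assms unfolding subfield_set_def
  by (auto simp: field_class.field_divide_inverse) (metis diff_conv_add_uminus)

lemma subfield_set_UNIV: "subfield_set UNIV"
  by (simp add: subfield_set_def)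

lemma subfield_set_sum:
  assumes "subfield_set K" "\<And>i. i \<in> I \<Longrightarrow> f i \<in> K"
  shows "sum f I \<in> K"
  using assms(2) by (induction I rule: infinite_finite_induct) (auto simp: subfield_setD[OF assms(1)])

lemma subfield_set_prod:
  assumes "subfield_set K" "\<And>i. i \<in> I \<Longrightarrow> f i \<in> K"
  shows "prod f I \<in> K"
  using assms(2) by (induction I rule: infinite_finite_induct) (auto simp: subfield_setD[OF assms(1)])

lemma subfield_set_power: "subfield_set K \<Longrightarrow> a \<in> K \<Longrightarrow> a ^ n \<in> K"
  by (induction n) (auto simp: subfield_setD)

lemma subfield_set_of_nat: "subfield_set K \<Longrightarrow> of_nat n \<in> K"
  by (induction n) (auto simp: subfield_setD)

definition mpolys :: "'a::zero set \<Rightarrow> nat set \<Rightarrow> 'a mpoly set" where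
  "mpolys K V = {p. (\<forall>m. lookup p m \<in> K) \<and> (\<forall>m\<in>keys p. keys m \<subseteq> V)}"

definition mvar :: "nat \<Rightarrow> 'a::comm_ring_1 mpoly" where
  "mvar i = Poly_Mapping.single (Poly_Mapping.single i 1) 1"

lemma mpolys_mono: "V \<subseteq> W \<Longrightarrow> K \<subseteq> M \<Longrightarrow> p \<in> mpolys K V \<Longrightarrow> p \<in> mpolys M W"
  unfolding mpolys_def by blast

lemma mpolys_sum:
  assumes "subfield_set K" "\<And>i. i \<in> I \<Longrightarrow> f i \<in> mpolys K V"
  shows "sum f I \<in> mpolys K V"
proof -
  have "keys m \<subseteq> V" if "m \<in> keys (sum f I)" for m
  proof -
    from that have "(\<Sum>i\<in>I. lookup (f i) m) \<noteq> 0" by (simp add: in_keys_iff lookup_sum)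
    then obtain i where "i \<in> I" "lookup (f i) m \<noteq> 0" by (meson sum.not_neutral_contains_not_neutral)
    thus ?thesis using assms(2)[of i] by (auto simp: mpolys_def in_keys_iff)
  qed
  thus ?thesis using assms by (auto simp: mpolys_def lookup_sum intro!: subfield_set_sum)
qed

lemma mpolys_single:
  assumes "subfield_set K" "c \<in> K" "keys m \<subseteq> V"
  shows "Poly_Mapping.single m c \<in> mpolys K V"
  using assms by (auto simp: mpolys_def lookup_single when_def subfield_setD)

lemma mpolys_closed:
  assumes "subfield_set K"
  shows "0 \<in> mpolys K V" "1 \<in> mpolys K V"
    "p \<in> mpolys K V \<Longrightarrow> q \<in> mpolys K V \<Longrightarrow> p + q \<in> mpolys K V"
    "p \<in> mpolys K V \<Longrightarrow> q \<in> mpolys K V \<Longrightarrow> p * q \<in> mpolys K V"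
    "p \<in> mpolys K V \<Longrightarrow> - p \<in> mpolys K V"
    "p \<in> mpolys K V \<Longrightarrow> q \<in> mpolys K V \<Longrightarrow> p - q \<in> mpolys K V"
    "i \<in> V \<Longrightarrow> mvar i \<in> mpolys K V"
proof -
  show "0 \<in> mpolys K V" using assms by (simp add: mpolys_def subfield_setD)
  show "1 \<in> mpolys K V"
    using mpolys_single[OF assms subfield_setD(2)[OF assms], of 0 V] by simp
  show add: "p + q \<in> mpolys K V" if "p \<in> mpolys K V" "q \<in> mpolys K V" for p q
    using that mpolys_sum[OF assms, of UNIV "\<lambda>b. if b then p else q" V] by (simp add: UNIV_bool add.commute)
  show un: "- p \<in> mpolys K V" if "p \<in> mpolys K V" for p
    using that subfield_setD(5)[OF assms] by (simp add: mpolys_def in_keys_iff)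
  show "p - q \<in> mpolys K V" if "p \<in> mpolys K V" "q \<in> mpolys K V" for p q
    using add[OF that(1) un[OF that(2)]] by simp
  show "p * q \<in> mpolys K V" if "p \<in> mpolys K V" "q \<in> mpolys K V" for p q
  proof (subst poly_mapping_mult_as_sum, intro mpolys_sum assms mpolys_single)
    fix m n assume "m \<in> keys p" "n \<in> keys q"
    hence "keys m \<subseteq> V" "keys n \<subseteq> V" using that by (auto simp: mpolys_def)
    thus "keys (m + n) \<subseteq> V" using keys_add[of m n] by blast
    show "lookup p m * lookup q n \<in> K" using that subfield_setD(4)[OF assms] by (simp add: mpolys_def)
  qed
  show "i \<in> V \<Longrightarrow> mvar i \<in> mpolys K V"
    unfolding mvar_def using assms subfield_setD(2) by (intro mpolys_single) auto
qed

lemma mpolys_power: "subfield_set K \<Longrightarrow> p \<in> mpolys K V \<Longrightarrow> p ^ n \<in> mpolys K V"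
  by (induction n) (auto simp: mpolys_closed)

definition monomial_value :: "(nat \<Rightarrow> 'k::comm_ring_1) \<Rightarrow> (nat \<Rightarrow>\<^sub>0 nat) \<Rightarrow> 'k" where
  "monomial_value v m = (\<Prod>i\<in>keys m. v i ^ lookup m i)"

lemma monomial_value_superset:
  "finite A \<Longrightarrow> keys m \<subseteq> A \<Longrightarrow> monomial_value v m = (\<Prod>i\<in>A. v i ^ lookup m i)"
  unfolding monomial_value_def by (rule prod.mono_neutral_left) (auto simp: in_keys_iff)

lemma monomial_value_add: "monomial_value v (m + n) = monomial_value v m * monomial_value v n"
proof -
  let ?A = "keys m \<union> keys n"
  have "monomial_value v (m + n) = (\<Prod>i\<in>?A. v i ^ lookup (m + n) i)"
    by (rule monomial_value_superset) (use keys_add[of m n] in auto)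
  also have "\<dots> = (\<Prod>i\<in>?A. v i ^ lookup m i) * (\<Prod>i\<in>?A. v i ^ lookup n i)"
    by (simp add: lookup_add power_add prod.distrib)
  also have "\<dots> = monomial_value v m * monomial_value v n"
    by (simp add: monomial_value_superset[of ?A])
  finally show ?thesis .
qed

lemma monomial_value_0 [simp]: "monomial_value v 0 = 1"
  by (simp add: monomial_value_def)

lemma monomial_value_single [simp]: "monomial_value v (Poly_Mapping.single i n) = v i ^ n"
  by (simp add: monomial_value_def)

text \<open>The coefficient map \<open>h\<close> makes it possible to evaluate polynomials over the
  ground field at points of the ultrapower; the identity for \<open>h\<close> gives
  \<open>eval_mpoly\<close>.\<close>

definition eval_hom :: "('a \<Rightarrow> 'k::comm_ring_1) \<Rightarrow> (nat \<Rightarrow> 'k) \<Rightarrow> 'a::zero mpoly \<Rightarrow> 'k" where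
  "eval_hom h v p = (\<Sum>m\<in>keys p. h (lookup p m) * monomial_value v m)"

lemma eval_mpoly_eq: "eval_mpoly v = eval_hom (\<lambda>c. c) v"
  by (simp add: fun_eq_iff eval_mpoly_def eval_hom_def monomial_value_def)

locale ring_hom_map =
  fixes h :: "'a::comm_ring_1 \<Rightarrow> 'k::comm_ring_1"
  assumes map_1: "h 1 = 1"
    and map_add: "h (x + y) = h x + h y"
    and map_mult: "h (x * y) = h x * h y"
begin

lemma map_0 [simp]: "h 0 = 0"
  using map_add[of 0 0] by simp

lemma eval_superset:
  "finite A \<Longrightarrow> keys p \<subseteq> A \<Longrightarrow> eval_hom h v p = (\<Sum>m\<in>A. h (lookup p m) * monomial_value v m)"
  unfolding eval_hom_def by (rule sum.mono_neutral_left) (auto simp: in_keys_iff)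

lemma eval_0 [simp]: "eval_hom h v 0 = 0"
  by (simp add: eval_hom_def)

lemma eval_single [simp]: "eval_hom h v (Poly_Mapping.single m c) = h c * monomial_value v m"
  by (simp add: eval_hom_def)

lemma eval_1 [simp]: "eval_hom h v 1 = 1"
  using eval_single[of v 0 1] by (simp add: map_1)

lemma eval_var [simp]: "eval_hom h v (mvar i) = v i"
  by (simp add: mvar_def map_1)

lemma eval_add: "eval_hom h v (p + q) = eval_hom h v p + eval_hom h v q"
proof -
  let ?A = "keys p \<union> keys q"
  have "eval_hom h v (p + q) = (\<Sum>m\<in>?A. h (lookup (p + q) m) * monomial_value v m)"
    by (rule eval_superset) (use keys_add[of p q] in auto)
  also have "\<dots> = (\<Sum>m\<in>?A. h (lookup p m) * monomial_value v m) + (\<Sum>m\<in>?A. h (lookup q m) * monomial_value v m)"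
    by (simp add: lookup_add map_add distrib_right sum.distrib)
  also have "\<dots> = eval_hom h v p + eval_hom h v q"
    by (simp add: eval_superset[of ?A])
  finally show ?thesis .
qed

lemma eval_minus: "eval_hom h v (- p) = - eval_hom h v p"
  using eval_add[of v p "- p"] by (simp add: eq_neg_iff_add_eq_0 add.commute)

lemma eval_diff: "eval_hom h v (p - q) = eval_hom h v p - eval_hom h v q"
  using eval_add[of v p "- q"] by (simp add: eval_minus)

lemma eval_sum: "eval_hom h v (sum f I) = (\<Sum>i\<in>I. eval_hom h v (f i))"
  by (induction I rule: infinite_finite_induct) (auto simp: eval_add)

lemma eval_mult: "eval_hom h v (p * q) = eval_hom h v p * eval_hom h v q"
proof -
  have "eval_hom h v (p * q) = (\<Sum>m\<in>keys p. \<Sum>n\<in>keys q.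
      h (lookup p m * lookup q n) * monomial_value v (m + n))"
    by (subst poly_mapping_mult_as_sum) (simp only: eval_sum eval_single)
  also have "\<dots> = eval_hom h v p * eval_hom h v q"
    by (simp add: map_mult monomial_value_add eval_hom_def sum_product mult_ac)
  finally show ?thesis .
qed

lemma eval_power: "eval_hom h v (p ^ n) = eval_hom h v p ^ n"
  by (induction n) (auto simp: eval_mult)

end

abbreviation eval_at :: "(nat \<Rightarrow> 'a::comm_ring_1) \<Rightarrow> 'a mpoly \<Rightarrow> 'a" where
  "eval_at \<equiv> eval_hom (\<lambda>c. c)"

lemma ring_hom_map_id: "ring_hom_map (\<lambda>c. c)"
  by standard auto

lemmas eval_at_0 [simp] = ring_hom_map.eval_0[OF ring_hom_map_id]
  and eval_at_1 [simp] = ring_hom_map.eval_1[OF ring_hom_map_id]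
  and eval_at_var [simp] = ring_hom_map.eval_var[OF ring_hom_map_id]
  and eval_at_single [simp] = ring_hom_map.eval_single[OF ring_hom_map_id]
  and eval_at_add = ring_hom_map.eval_add[OF ring_hom_map_id]
  and eval_at_minus = ring_hom_map.eval_minus[OF ring_hom_map_id]
  and eval_at_diff = ring_hom_map.eval_diff[OF ring_hom_map_id]
  and eval_at_mult = ring_hom_map.eval_mult[OF ring_hom_map_id]

lemma eval_hom_cong:
  assumes "p \<in> mpolys K V" "\<And>i. i \<in> V \<Longrightarrow> v i = w i"
  shows "eval_hom h v p = eval_hom h w p"
proof -
  have "monomial_value v m = monomial_value w m" if "m \<in> keys p" for m
    using that assms unfolding mpolys_def monomial_value_def
    by (intro prod.cong) (auto dest!: bspec subsetD)
  thus ?thesis by (simp add: eval_hom_def)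
qed

lemma eval_hom_in_subfield:
  assumes M: "subfield_set M" and "p \<in> mpolys K V" "\<And>i. i \<in> V \<Longrightarrow> v i \<in> M" "\<And>c. c \<in> K \<Longrightarrow> h c \<in> M"
  shows "eval_hom h v p \<in> M"
  unfolding eval_hom_def monomial_value_def using assms
  by (intro subfield_set_sum subfield_setD(4)[OF M] subfield_set_prod subfield_set_power)
    (auto simp: mpolys_def dest!: bspec subsetD)

section \<open>Weighted degrees\<close>

text \<open>The weight is later the total exponent or the exponent of a single variable. The
  inserted \<open>0\<close> is the degree of the zero polynomial.\<close>

definition wdeg :: "('b \<Rightarrow> nat) \<Rightarrow> ('b \<Rightarrow>\<^sub>0 'a::zero) \<Rightarrow> nat" where
  "wdeg \<phi> p = Max (insert 0 (\<phi> ` keys p))"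

lemma wdeg_le_iff: "wdeg \<phi> p \<le> d \<longleftrightarrow> (\<forall>m\<in>keys p. \<phi> m \<le> d)"
  by (simp add: wdeg_def)

lemma le_wdeg: "m \<in> keys p \<Longrightarrow> \<phi> m \<le> wdeg \<phi> p"
  by (simp add: wdeg_def)

lemma wdeg_attained: "p \<noteq> 0 \<Longrightarrow> \<exists>m\<in>keys p. \<phi> m = wdeg \<phi> p"
proof -
  assume "p \<noteq> 0"
  then obtain m0 where m0: "m0 \<in> keys p"
    using poly_mapping_eqI[of p 0] by (auto simp: in_keys_iff)
  have "wdeg \<phi> p \<in> insert 0 (\<phi> ` keys p)" unfolding wdeg_def by (rule Max_in) auto
  thus ?thesis
  proof
    assume "wdeg \<phi> p = 0"
    thus ?thesis using le_wdeg[OF m0, of \<phi>] m0 by auto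
  qed auto
qed

text \<open>In a domain the parts of highest weight have a nonzero product, and all other products
  of terms have smaller weight, so nothing cancels it.\<close>

lemma wdeg_mult:
  fixes p q :: "'b::{ordered_cancel_comm_monoid_add, linorder} \<Rightarrow>\<^sub>0 'a::idom"
  assumes add: "\<And>m n. \<phi> (m + n) = \<phi> m + \<phi> n" and "p \<noteq> 0" "q \<noteq> 0"
  shows "wdeg \<phi> (p * q) = wdeg \<phi> p + wdeg \<phi> q"
proof (rule antisym)
  show "wdeg \<phi> (p * q) \<le> wdeg \<phi> p + wdeg \<phi> q"
    unfolding wdeg_le_iff
  proof
    fix k assume "k \<in> keys (p * q)"
    then obtain m n where "k = m + n" "m \<in> keys p" "n \<in> keys q" using keys_mult[of p q] by blast
    thus "\<phi> k \<le> wdeg \<phi> p + wdeg \<phi> q" using add_mono[OF le_wdeg le_wdeg, of m p n q \<phi> \<phi>] by (simp add: add)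
  qed
next
  \<comment> \<open>The form of highest weight, which plays the role of a leading term.\<close>
  define part where "part r = (\<Sum>m\<in>{m \<in> keys r. \<phi> m = wdeg \<phi> r}. Poly_Mapping.single m (lookup r m))"
    for r :: "'b \<Rightarrow>\<^sub>0 'a"
  have look: "lookup (part r) m = (if \<phi> m = wdeg \<phi> r then lookup r m else 0)" for r m
    by (simp add: part_def lookup_sum lookup_single when_def in_keys_iff)
  have nz: "part r \<noteq> 0" if "r \<noteq> 0" for r
  proof -
    obtain m where "m \<in> keys r" "\<phi> m = wdeg \<phi> r" using wdeg_attained[OF \<open>r \<noteq> 0\<close>] by blast
    hence "lookup (part r) m \<noteq> 0" by (simp add: look in_keys_iff)
    thus ?thesis by auto
  qed
  let ?a = "part p" and ?b = "part q"
  have low: "\<phi> m < wdeg \<phi> r" if "m \<in> keys (r - part r)" for r m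
    using that le_wdeg[of m r \<phi>] by (auto simp: in_keys_iff lookup_minus look split: if_splits)
  have top: "\<phi> m = wdeg \<phi> r" if "m \<in> keys (part r)" for r m
    using that by (auto simp: in_keys_iff look split: if_splits)
  have "?a * ?b \<noteq> 0" using nz assms by simp
  then obtain k where k: "k \<in> keys (?a * ?b)" using wdeg_attained by blast
  then obtain m n where "k = m + n" "m \<in> keys ?a" "n \<in> keys ?b" using keys_mult[of ?a ?b] by blast
  hence \<phi>k: "\<phi> k = wdeg \<phi> p + wdeg \<phi> q" using top by (simp add: add)
  \<comment> \<open>The exponents of the last two products have smaller weight than
    \<open>k\<close>, so the coefficient at \<open>k\<close> comes from \<open>?a * ?b\<close>
    alone.\<close>
  have decomp: "p * q = ?a * ?b + (?a * (q - ?b) + (p - ?a) * q)" by (simp add: algebra_simps)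
  have "k \<notin> keys (?a * (q - ?b))"
  proof
    assume "k \<in> keys (?a * (q - ?b))"
    then obtain m n where "k = m + n" "m \<in> keys ?a" "n \<in> keys (q - ?b)"
      using keys_mult[of ?a "q - ?b"] by blast
    thus False using \<phi>k top[of m p] low[of n q] by (simp add: add)
  qed
  moreover have "k \<notin> keys ((p - ?a) * q)"
  proof
    assume "k \<in> keys ((p - ?a) * q)"
    then obtain m n where "k = m + n" "m \<in> keys (p - ?a)" "n \<in> keys q"
      using keys_mult[of "p - ?a" q] by blast
    thus False using \<phi>k low[of m p] le_wdeg[of n q \<phi>] by (simp add: add)
  qed
  ultimately have "lookup (p * q) k = lookup (?a * ?b) k"
    by (subst decomp) (simp add: lookup_add in_keys_iff)
  hence "k \<in> keys (p * q)" using k by (simp add: in_keys_iff)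
  thus "wdeg \<phi> p + wdeg \<phi> q \<le> wdeg \<phi> (p * q)" using le_wdeg[of k "p * q" \<phi>] \<phi>k by simp
qed

definition total_exponent :: "(nat \<Rightarrow>\<^sub>0 nat) \<Rightarrow> nat" where
  "total_exponent m = (\<Sum>i\<in>keys m. lookup m i)"

lemma total_exponent_add: "total_exponent (m + n) = total_exponent m + total_exponent n"
proof -
  have *: "total_exponent k = (\<Sum>i\<in>A. lookup k i)" if "finite A" "keys k \<subseteq> A" for k A
    unfolding total_exponent_def using that by (intro sum.mono_neutral_left) (auto simp: in_keys_iff)
  show ?thesis
    using *[of "keys m \<union> keys n" "m + n"] *[of "keys m \<union> keys n" m] *[of "keys m \<union> keys n" n] keys_add[of m n]
    by (simp add: lookup_add sum.distrib)
qed

lemma total_exponent_eq_0: "total_exponent m = 0 \<Longrightarrow> m = 0"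
  by (rule poly_mapping_eqI) (auto simp: total_exponent_def in_keys_iff)

section \<open>Polynomials in a distinguished variable\<close>

text \<open>\<open>P\<close> is regarded as a polynomial in \<open>z\<close> over the ring of
  polynomials without \<open>z\<close>; substituting \<open>mvar z\<close> undoes this
  (\<open>poly_split_var\<close>).\<close>

definition split_var :: "nat \<Rightarrow> 'a::comm_ring_1 mpoly \<Rightarrow> 'a mpoly poly" where
  "split_var z P = (\<Sum>m\<in>keys P.
     Polynomial.monom (Poly_Mapping.single (m - Poly_Mapping.single z (lookup m z)) (lookup P m)) (lookup m z))"

lemma mvar_power: "(mvar z :: 'a::comm_ring_1 mpoly) ^ k = Poly_Mapping.single (Poly_Mapping.single z k) 1"
proof (induction k)
  case (Suc k)
  have "(mvar z :: 'a mpoly) ^ Suc k = Poly_Mapping.single (Poly_Mapping.single z 1 + Poly_Mapping.single z k) 1"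
    unfolding power_Suc Suc by (simp add: mvar_def mult_single)
  also have "Poly_Mapping.single z 1 + Poly_Mapping.single z k = Poly_Mapping.single z (Suc k)"
    by (simp flip: single_add)
  finally show ?case .
qed simp

lemma exponent_split:
  fixes m :: "nat \<Rightarrow>\<^sub>0 nat"
  shows "m - Poly_Mapping.single z (lookup m z) + Poly_Mapping.single z (lookup m z) = m"
  by (rule poly_mapping_eqI) (simp add: lookup_add lookup_minus lookup_single when_def)

lemma poly_split_var: "poly (split_var z P) (mvar z) = P"
proof -
  have "poly (split_var z P) (mvar z) = (\<Sum>m\<in>keys P. Poly_Mapping.single m (lookup P m))"
    unfolding split_var_def poly_sum poly_monom mvar_power mult_single exponent_split by simp
  thus ?thesis using poly_mapping_as_sum[of P] by simp
qed

lemma keys_exponent_remove: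
  fixes m :: "nat \<Rightarrow>\<^sub>0 nat"
  shows "keys (m - Poly_Mapping.single z (lookup m z)) = keys m - {z}"
  by (auto simp: in_keys_iff lookup_minus lookup_single when_def split: if_splits)

lemma coeff_split_var:
  assumes "subfield_set K" "P \<in> mpolys K V"
  shows "coeff (split_var z P) k \<in> mpolys K (V - {z})"
  unfolding split_var_def coeff_sum coeff_monom
proof (intro mpolys_sum assms)
  fix m assume m: "m \<in> keys P"
  have "Poly_Mapping.single (m - Poly_Mapping.single z (lookup m z)) (lookup P m) \<in> mpolys K (V - {z})"
    using assms m by (intro mpolys_single) (auto simp: mpolys_def keys_exponent_remove)
  thus "(if lookup m z = k
      then Poly_Mapping.single (m - Poly_Mapping.single z (lookup m z)) (lookup P m) else 0)
      \<in> mpolys K (V - {z})"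
    using mpolys_closed(1)[OF assms(1), of "V - {z}"] by (split if_split) blast
qed

lemma degree_split_var: "Polynomial.degree (split_var z P) \<le> wdeg (\<lambda>m. lookup m z) P"
  unfolding split_var_def
  by (intro degree_sum_le) (auto intro!: order.trans[OF degree_monom_le] le_wdeg)

lemma poly_in_mpolys:
  assumes "subfield_set K" "\<And>k. coeff Q k \<in> mpolys K V" "q \<in> mpolys K V"
  shows "poly Q q \<in> mpolys K V"
  unfolding poly_altdef using assms by (intro mpolys_sum mpolys_closed mpolys_power) auto

lemma wdeg_poly_mvar:
  assumes "\<And>k. coeff Q k \<in> mpolys K (V - {z})"
  shows "wdeg (\<lambda>m. lookup m z) (poly Q (mvar z)) \<le> Polynomial.degree Q"
  unfolding wdeg_le_iff
proof
  fix k assume "k \<in> keys (poly Q (mvar z))"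
  hence "(\<Sum>i\<le>Polynomial.degree Q. lookup (coeff Q i * mvar z ^ i) k) \<noteq> 0"
    by (simp add: in_keys_iff poly_altdef lookup_sum)
  then obtain i where i: "i \<le> Polynomial.degree Q" "lookup (coeff Q i * mvar z ^ i) k \<noteq> 0"
    by (metis (no_types, lifting) atMost_iff sum.not_neutral_contains_not_neutral)
  hence "k \<in> keys (coeff Q i * mvar z ^ i)" by (simp add: in_keys_iff)
  then obtain m n where mn: "k = m + n" "m \<in> keys (coeff Q i)" "n \<in> keys (mvar z ^ i :: 'a mpoly)"
    using keys_mult by blast
  have "n = Poly_Mapping.single z i" using mn(3) by (simp add: mvar_power split: if_splits)
  moreover have "z \<notin> keys m" using assms[of i] mn(2) unfolding mpolys_def by blast
  ultimately show "lookup k z \<le> Polynomial.degree Q"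
    using i by (simp add: mn lookup_add in_keys_iff)
qed

context ring_hom_map
begin

lemma eval_poly: "eval_hom h v (poly Q q) = poly (map_poly (eval_hom h v) Q) (eval_hom h v q)"
proof (induction Q)
  case (pCons a Q)
  thus ?case by (cases "a = 0 \<and> Q = 0") (auto simp: map_poly_pCons eval_add eval_mult)
qed simp

end

text \<open>Long division without inverting the leading coefficient, at the cost of multiplying the
  dividend by a power of it. The set \<open>R\<close> records that quotient and remainder stay over
  the coefficient ring of \<open>F\<close> and \<open>Q\<close>.\<close>

lemma pseudo_division:
  fixes F :: "'r::idom poly"
  assumes closed: "0 \<in> R" "\<And>a b. a \<in> R \<Longrightarrow> b \<in> R \<Longrightarrow> a - b \<in> R" "\<And>a b. a \<in> R \<Longrightarrow> b \<in> R \<Longrightarrow> a * b \<in> R"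
    and F: "F \<noteq> 0" "\<And>k. coeff F k \<in> R"
    and Q: "\<And>k. coeff Q k \<in> R"
  shows "\<exists>N q r. smult (lead_coeff F ^ N) Q = F * q + r \<and> (\<forall>k. coeff q k \<in> R) \<and> (\<forall>k. coeff r k \<in> R) \<and>
     (r = 0 \<or> Polynomial.degree r < Polynomial.degree F)"
  using Q
\<comment> \<open>The length of the coefficient list, unlike the degree, also drops when a constant
  becomes zero.\<close>
proof (induction "length (coeffs Q)" arbitrary: Q rule: less_induct)
  case less
  let ?b = "lead_coeff F" and ?d = "Polynomial.degree F"
  show ?case
  proof (cases "Q = 0 \<or> Polynomial.degree Q < ?d")
    case True
    thus ?thesis using less.prems closed(1) by (intro exI[of _ 0] exI[of _ 0] exI[of _ Q]) auto
  next
    case False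
    \<comment> \<open>\<open>F * c\<close> has the same leading term as
      \<open>smult ?b Q\<close>.\<close>
    define c where "c = Polynomial.monom (lead_coeff Q) (Polynomial.degree Q - ?d)"
    define Q' where "Q' = smult ?b Q - F * c"
    have add: "a + b \<in> R" if "a \<in> R" "b \<in> R" for a b
      using closed(2)[OF that(1) closed(2)[OF closed(1) that(2)]] by simp
    have cR: "coeff c k \<in> R" for k
      using less.prems closed(1) by (simp add: c_def coeff_monom)
    have FcR: "coeff (F * c) k \<in> R" for k
    proof -
      have "(\<Sum>i\<in>I. coeff F i * coeff c (k - i)) \<in> R" if "finite I" for I
        using that by (induction I) (auto intro: closed add F cR)
      thus ?thesis by (simp add: coeff_mult)
    qed
    have Q'R: "coeff Q' k \<in> R" for k
      by (simp add: Q'_def closed F less.prems FcR)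
    have "length (coeffs Q') < length (coeffs Q)"
    proof (cases "Q' = 0")
      case True
      thus ?thesis using False by (simp add: length_coeffs_degree)
    next
      case Q'0: False
      have lc: "lead_coeff (F * c) = ?b * lead_coeff Q"
        using False by (simp add: lead_coeff_mult c_def Polynomial.degree_monom_eq)
      have "c \<noteq> 0" using False by (simp add: c_def)
      hence dFc: "Polynomial.degree (F * c) = Polynomial.degree Q"
        using False F by (simp add: degree_mult_eq c_def Polynomial.degree_monom_eq)
      have "Polynomial.degree Q' \<le> Polynomial.degree Q"
        unfolding Q'_def by (rule degree_diff_le) (auto simp: dFc)
      moreover have "coeff Q' (Polynomial.degree Q) = 0"
        using lc by (simp add: Q'_def dFc)
      ultimately have "Polynomial.degree Q' < Polynomial.degree Q"
        using Q'0 by (metis leading_coeff_0_iff le_neq_implies_less)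
      thus ?thesis using Q'0 False by (simp add: length_coeffs_degree)
    qed
    from less.hyps[OF this Q'R] obtain N q r where
      *: "smult (?b ^ N) Q' = F * q + r" "\<forall>k. coeff q k \<in> R" "\<forall>k. coeff r k \<in> R"
        "r = 0 \<or> Polynomial.degree r < ?d" by blast
    have "smult (?b ^ Suc N) Q = smult (?b ^ N) Q' + smult (?b ^ N) (F * c)"
      by (simp add: Q'_def smult_diff_right mult.commute)
    also have "\<dots> = F * (q + smult (?b ^ N) c) + r"
      by (simp add: *(1) algebra_simps)
    finally have eq: "smult (?b ^ Suc N) Q = F * (q + smult (?b ^ N) c) + r" .
    have "?b ^ n * coeff c k \<in> R" for n k
      using cR F by (induction n) (auto simp: mult.assoc closed)
    hence "\<forall>k. coeff (q + smult (?b ^ N) c) k \<in> R" using *(2) by (auto intro: add)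
    thus ?thesis using eq *(3,4) by blast
  qed
qed

lemma wdeg_mono: "keys p \<subseteq> keys q \<Longrightarrow> wdeg \<phi> p \<le> wdeg \<phi> q"
  unfolding wdeg_le_iff by (auto intro: le_wdeg)

lemma wdeg_total_eq_0:
  assumes "wdeg total_exponent p = 0"
  shows "p = Poly_Mapping.single 0 (lookup p 0)"
proof (rule poly_mapping_eqI)
  fix m
  have "m \<notin> keys p" if "m \<noteq> 0"
    using le_wdeg[of m p total_exponent] assms total_exponent_eq_0[of m] that by auto
  thus "lookup p m = lookup (Poly_Mapping.single 0 (lookup p 0)) m"
    by (cases "m = 0") (auto simp: lookup_single when_def in_keys_iff)
qed

text \<open>\<open>f\<close> is an element of the vanishing ideal of \<open>w\<close> of least
  degree in \<open>z\<close> and then of least total degree. Minimality refers to coefficients in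
  the full field, which yields absolute irreducibility, while \<open>descent\<close> puts
  \<open>f\<close> itself over \<open>K\<close>. Pseudo-division by \<open>f\<close> multiplies only
  by powers of its leading coefficient in \<open>z\<close>, which \<open>indep\<close> keeps from
  vanishing at \<open>w\<close>.\<close>

lemma generic_hypersurface:
  fixes h :: "'a::field \<Rightarrow> 'k::idom" and w :: "nat \<Rightarrow> 'k"
  assumes hom: "ring_hom_map h" and K: "subfield_set K" and z: "z \<in> V"
    and descent: "\<And>P. P \<in> mpolys UNIV V \<Longrightarrow> P \<noteq> 0 \<Longrightarrow> eval_hom h w P = 0 \<Longrightarrow>
           \<exists>P'\<in>mpolys K V. P' \<noteq> 0 \<and> eval_hom h w P' = 0 \<and> keys P' \<subseteq> keys P"
    and indep: "\<And>P. P \<in> mpolys UNIV (V - {z}) \<Longrightarrow> eval_hom h w P = 0 \<Longrightarrow> P = 0"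
    and alg: "P0 \<in> mpolys UNIV V" "P0 \<noteq> 0" "eval_hom h w P0 = 0"
  obtains f where "f \<in> mpolys K V" "f \<noteq> 0" "eval_hom h w f = 0"
    "\<And>a b. a \<in> mpolys UNIV V \<Longrightarrow> b \<in> mpolys UNIV V \<Longrightarrow> f = a * b \<Longrightarrow>
        wdeg total_exponent a = 0 \<or> wdeg total_exponent b = 0"
    "\<And>P. P \<in> mpolys K V \<Longrightarrow> eval_hom h w P = 0 \<Longrightarrow>
        \<exists>g\<in>mpolys K V. eval_hom h w g \<noteq> 0 \<and> f dvd g * P"
proof -
  interpret ring_hom_map h by fact
  define I where "I = {P \<in> mpolys UNIV V. P \<noteq> 0 \<and> eval_hom h w P = 0}"
  let ?dz = "wdeg (\<lambda>m. lookup m z) :: 'a mpoly \<Rightarrow> nat" and ?dt = "wdeg total_exponent :: 'a mpoly \<Rightarrow> nat"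
  have UK: "p \<in> mpolys UNIV V" if "p \<in> mpolys K V" for p
    using mpolys_mono[OF _ _ that, of V UNIV] by simp
  have "P0 \<in> I" using alg by (simp add: I_def)
  then obtain f0 where f0: "f0 \<in> I" and min0: "\<And>P. (P, f0) \<in> measures [?dz, ?dt] \<Longrightarrow> P \<notin> I"
    using wfE_min[OF wf_measures] by metis
  then obtain f where f: "f \<in> mpolys K V" "f \<noteq> 0" "eval_hom h w f = 0" "keys f \<subseteq> keys f0"
    using descent[of f0] by (auto simp: I_def)
  have fI: "f \<in> I" using f UK by (simp add: I_def)
  \<comment> \<open>Passing to a subset of the exponents raises neither degree, so \<open>f\<close>
    is as minimal as \<open>f0\<close>.\<close>
  have le: "?dz f \<le> ?dz f0" "?dt f \<le> ?dt f0" using f(4) by (auto intro: wdeg_mono)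
  have min: "P \<notin> I" if "?dz P < ?dz f \<or> ?dz P = ?dz f \<and> ?dt P < ?dt f" for P
    using that le by (intro min0) auto
  \<comment> \<open>A factor that vanishes at \<open>w\<close> belongs to \<open>I\<close>, so by
    minimality it takes up the whole degree of \<open>f\<close>.\<close>
  have factor: "?dt b = 0" if "a \<in> mpolys UNIV V" "f = a * b" "eval_hom h w a = 0" for a b
  proof -
    have nz: "a \<noteq> 0" "b \<noteq> 0" using that f by auto
    have "?dz f = ?dz a + ?dz b" "?dt f = ?dt a + ?dt b"
      unfolding \<open>f = a * b\<close> using nz by (auto intro!: wdeg_mult simp: lookup_add total_exponent_add)
    moreover have "a \<in> I" using that nz by (simp add: I_def)
    ultimately show ?thesis using min[of a] by fastforce
  qed
  show thesis
  proof (rule that[OF f(1-3)])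
    fix a b assume ab: "a \<in> mpolys UNIV V" "b \<in> mpolys UNIV V" "f = a * b"
    have "eval_hom h w a = 0 \<or> eval_hom h w b = 0" using f(3) ab(3) by (simp add: eval_mult)
    thus "?dt a = 0 \<or> ?dt b = 0" using factor[of a b] factor[of b a] ab by (auto simp: mult.commute)
  next
    fix P assume P: "P \<in> mpolys K V" "eval_hom h w P = 0"
    let ?F = "split_var z f" and ?Q = "split_var z P"
    have F0: "?F \<noteq> 0" using poly_split_var[of z f] f(2) by auto
    note cF = coeff_split_var[OF K f(1), of z] and cQ = coeff_split_var[OF K P(1), of z]
    obtain N q r where qr: "smult (lead_coeff ?F ^ N) ?Q = ?F * q + r"
      "\<forall>k. coeff q k \<in> mpolys K (V - {z})" "\<forall>k. coeff r k \<in> mpolys K (V - {z})"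
      "r = 0 \<or> Polynomial.degree r < Polynomial.degree ?F"
      using pseudo_division[of "mpolys K (V - {z})" ?F ?Q, OF _ _ _ F0 cF cQ]
      by (auto simp: mpolys_closed[OF K])
    let ?g = "lead_coeff ?F ^ N"
    define r' where "r' = poly r (mvar z)"
    have "poly (smult ?g ?Q) (mvar z) = poly (?F * q + r) (mvar z)" using qr(1) by simp
    hence eq: "?g * P = f * poly q (mvar z) + r'"
      by (simp only: poly_smult poly_mult poly_add poly_split_var r'_def)
    \<comment> \<open>Otherwise the remainder would be an element of \<open>I\<close> of smaller
      degree in \<open>z\<close>.\<close>
    have "r' = 0"
    proof (rule ccontr)
      assume "r' \<noteq> 0"
      hence "Polynomial.degree r < Polynomial.degree ?F" using qr(4) by (auto simp: r'_def)
      moreover have "?dz r' \<le> Polynomial.degree r"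
        unfolding r'_def using qr(3) by (intro wdeg_poly_mvar) auto
      ultimately have "?dz r' < ?dz f" using degree_split_var[of z f] by simp
      hence "r' \<notin> I" using min by blast
      moreover have "r' \<in> mpolys UNIV V" unfolding r'_def
        using qr(3) z by (intro UK poly_in_mpolys[OF K] mpolys_closed(7)[OF K])
          (auto intro: mpolys_mono[of "V - {z}" V K K])
      moreover have "eval_hom h w r' = eval_hom h w (?g * P - f * poly q (mvar z))" using eq by simp
      hence "eval_hom h w r' = 0" using f P by (simp add: eval_diff eval_mult)
      ultimately show False using \<open>r' \<noteq> 0\<close> by (simp add: I_def)
    qed
    hence "f dvd ?g * P" using eq by simp
    moreover have "?g \<in> mpolys K V"
      using cF by (intro mpolys_power K) (auto intro: mpolys_mono[of "V - {z}" V K K])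
    \<comment> \<open>The leading coefficient is a nonzero polynomial without
      \<open>z\<close>.\<close>
    moreover have "eval_hom h w (lead_coeff ?F) \<noteq> 0"
      using indep[of "lead_coeff ?F"] cF F0 mpolys_mono[of "V - {z}" "V - {z}" K UNIV] by force
    hence "eval_hom h w ?g \<noteq> 0" by (simp add: eval_power)
    ultimately show "\<exists>g\<in>mpolys K V. eval_hom h w g \<noteq> 0 \<and> f dvd g * P" by blast
  qed
qed

section \<open>Irreducibility in \<open>mpoly_ring\<close>\<close>

lemma carrier_mpoly_ring: "carrier (mpoly_ring K e) = mpolys K {..e}"
  by (simp add: mpoly_ring_def mpolys_def)

lemma mpoly_ring_simps:
  "x \<otimes>\<^bsub>mpoly_ring K e\<^esub> y = x * y" "\<one>\<^bsub>mpoly_ring K e\<^esub> = 1" "\<zero>\<^bsub>mpoly_ring K e\<^esub> = 0"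
  by (auto simp: mpoly_ring_def ring_of_type_algebra_def)

text \<open>Nonzero polynomials of total degree zero are constants and hence units. If the cofactor
  of a proper factor were such a constant, \<open>f\<close> would divide the factor; so the factor
  itself is constant.\<close>

lemma absolutely_irreducibleI:
  fixes f :: "'a::alg_closed_field mpoly"
  assumes f: "f \<noteq> 0" "f \<in> mpolys UNIV {..e}" "\<not> f dvd 1"
    and fac: "\<And>a b. a \<in> mpolys UNIV {..e} \<Longrightarrow> b \<in> mpolys UNIV {..e} \<Longrightarrow> f = a * b \<Longrightarrow>
        wdeg total_exponent a = 0 \<or> wdeg total_exponent b = 0"
  shows "absolutely_irreducible e f"
proof -
  let ?R = "mpoly_ring UNIV e :: 'a mpoly ring"
  have const: "\<exists>b'\<in>mpolys UNIV {..e}. b * b' = 1"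
    if "b \<noteq> 0" "wdeg total_exponent b = 0" for b :: "'a mpoly"
  proof -
    let ?c = "lookup b 0"
    have b: "b = Poly_Mapping.single 0 ?c" using wdeg_total_eq_0[OF that(2)] .
    hence "?c \<noteq> 0" using that(1) by (metis single_zero)
    hence "b * Poly_Mapping.single 0 (inverse ?c) = 1"
      by (subst b) (simp add: mult_single)
    moreover have "Poly_Mapping.single 0 (inverse ?c) \<in> mpolys UNIV {..e}"
      by (rule mpolys_single) (auto simp: subfield_set_UNIV)
    ultimately show ?thesis by blast
  qed
  have "f \<notin> Units ?R" using f(3) by (auto simp: Units_def mpoly_ring_simps dvd_def)
  moreover have "b \<in> Units ?R" if b: "b \<in> carrier ?R" and pf: "properfactor ?R b f" for b
  proof -
    from pf obtain c where c: "c \<in> mpolys UNIV {..e}" "f = b * c"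
      by (auto simp: properfactor_def factor_def carrier_mpoly_ring mpoly_ring_simps)
    have nz: "b \<noteq> 0" "c \<noteq> 0" using c f by auto
    have "wdeg total_exponent c \<noteq> 0"
    proof
      assume "wdeg total_exponent c = 0"
      then obtain c' where c': "c' \<in> mpolys UNIV {..e}" "c * c' = 1" using const nz by blast
      hence "b = f * c'" by (simp add: c(2) mult.assoc)
      hence "f divides\<^bsub>?R\<^esub> b" using c' by (auto simp: factor_def carrier_mpoly_ring mpoly_ring_simps)
      thus False using pf by (simp add: properfactor_def)
    qed
    hence "wdeg total_exponent b = 0" using fac[of b c] c b by (auto simp: carrier_mpoly_ring)
    then obtain b' where "b' \<in> mpolys UNIV {..e}" "b * b' = 1" using const nz by blast
    thus ?thesis using b by (auto simp: Units_def carrier_mpoly_ring mpoly_ring_simps mult.commute)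
  qed
  ultimately show ?thesis using f(1)
    by (simp add: absolutely_irreducible_def ring_irreducible_def Divisibility.irreducible_def mpoly_ring_simps)
qed

section \<open>Ultrapowers\<close>

text \<open>Zorn's lemma in the reversed order gives a minimal proper filter \<open>U\<close>. It
  decides every \<open>P\<close>, because its restriction to \<open>P\<close> is either improper or
  \<open>U\<close> itself.\<close>

lemma ultrafilter_exists:
  fixes F0 :: "'i filter"
  assumes "F0 \<noteq> bot"
  shows "\<exists>U. U \<le> F0 \<and> U \<noteq> bot \<and> (\<forall>P. eventually P U \<or> eventually (\<lambda>i. \<not> P i) U)"
proof -
  have "\<exists>U\<in>{F. F \<noteq> bot \<and> F \<le> F0}. \<forall>F\<in>{F. F \<noteq> bot \<and> F \<le> F0}. F \<le> U \<longrightarrow> F = U"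
  proof (rule predicate_Zorn)
    show "partial_order_on {F. F \<noteq> bot \<and> F \<le> F0} (relation_of (\<ge>) {F. F \<noteq> bot \<and> F \<le> F0})"
      by (rule partial_order_on_relation_ofI) auto
  next
    fix C assume "C \<in> Chains (relation_of (\<ge>) {F. F \<noteq> bot \<and> F \<le> F0})"
    hence C: "C \<subseteq> {F. F \<noteq> bot \<and> F \<le> F0}" "\<And>F G. F \<in> C \<Longrightarrow> G \<in> C \<Longrightarrow> F \<le> G \<or> G \<le> F"
      by (auto simp: Chains_def relation_of_def)
    show "\<exists>u\<in>{F. F \<noteq> bot \<and> F \<le> F0}. \<forall>F\<in>C. u \<le> F"
    proof (cases "C = {}")
      case True
      thus ?thesis using assms by auto
    next
      case False
      \<comment> \<open>A chain is directed downwards, so what holds eventually for its infimum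
        already does so for a member; hence the infimum is proper.\<close>
      have "eventually P (Inf C) \<longleftrightarrow> (\<exists>F\<in>C. eventually P F)" for P
      proof (rule eventually_Inf_base[OF False])
        fix F G assume "F \<in> C" "G \<in> C"
        thus "\<exists>H\<in>C. H \<le> inf F G" using C(2)[of F G] by (metis inf.orderE inf.absorb2 order_refl)
      qed
      hence "Inf C \<noteq> bot" using C by (force simp: trivial_limit_def)
      moreover from False obtain F where "F \<in> C" by blast
      hence "Inf C \<le> F0" using C by (auto intro: Inf_lower2)
      ultimately show ?thesis by (auto intro!: bexI[of _ "Inf C"] Inf_lower)
    qed
  qed
  then obtain U where U: "U \<noteq> bot" "U \<le> F0" and min: "\<And>F. F \<noteq> bot \<Longrightarrow> F \<le> U \<Longrightarrow> F = U"
    by (auto intro: order_trans)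
  have "eventually P U \<or> eventually (\<lambda>i. \<not> P i) U" for P
  proof (cases "inf U (principal {i. P i}) = bot")
    case True
    thus ?thesis by (auto simp: trivial_limit_def eventually_inf_principal)
  next
    case False
    hence "inf U (principal {i. P i}) = U" by (intro min) auto
    moreover have "eventually P (inf U (principal {i. P i}))" by (simp add: eventually_inf_principal)
    ultimately show ?thesis by simp
  qed
  thus ?thesis using U by blast
qed

text \<open>The indices are sets over \<open>'i\<close>. Refining the filter of finite sets ensures
  that almost every index is finite and contains any prescribed element
  (\<open>eventually_ultra_member\<close>).\<close>

definition ultra :: "'i set filter" where
  "ultra = (SOME U. U \<le> finite_sets_at_top \<and> U \<noteq> bot \<and> (\<forall>P. eventually P U \<or> eventually (\<lambda>i. \<not> P i) U))"

lemma ultra: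
  "ultra \<le> finite_sets_at_top" "ultra \<noteq> bot" "eventually P ultra \<or> eventually (\<lambda>i. \<not> P i) ultra"
  using someI_ex[OF ultrafilter_exists[OF finite_subsets_at_top_neq_bot[of UNIV]]]
  unfolding ultra_def[symmetric] by blast+

lemma not_eventually_ultra: "\<not> eventually P ultra \<longleftrightarrow> eventually (\<lambda>i. \<not> P i) ultra"
proof
  assume "eventually (\<lambda>i. \<not> P i) ultra"
  thus "\<not> eventually P ultra" using ultra(2) eventually_conj[of P ultra "\<lambda>i. \<not> P i"]
    by (auto simp: eventually_False)
qed (use ultra(3) in blast)

lemma eventually_ultra_member: "eventually (\<lambda>i. finite i \<and> b \<in> i) ultra"
  by (rule filter_leD[OF ultra(1)]) (auto simp: eventually_finite_subsets_at_top intro!: exI[of _ "{b}"])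

\<comment> \<open>The ultrapower as an algebraically closed field of characteristic zero\<close>
quotient_type ('i, 'a) ultrapower = "'i set \<Rightarrow> 'a" / "\<lambda>S Y. eventually (\<lambda>i. S i = Y i) ultra"
  by (auto intro!: equivpI reflpI sympI transpI elim: eventually_mono eventually_elim2)

instantiation ultrapower :: (type, field) field
begin

lift_definition zero_ultrapower :: "('a, 'b) ultrapower" is "\<lambda>i. 0" .
lift_definition one_ultrapower :: "('a, 'b) ultrapower" is "\<lambda>i. 1" .
lift_definition plus_ultrapower :: "('a, 'b) ultrapower \<Rightarrow> ('a, 'b) ultrapower \<Rightarrow> ('a, 'b) ultrapower"
  is "\<lambda>S Y i. S i + Y i" by (auto elim: eventually_elim2)
lift_definition minus_ultrapower :: "('a, 'b) ultrapower \<Rightarrow> ('a, 'b) ultrapower \<Rightarrow> ('a, 'b) ultrapower"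
  is "\<lambda>S Y i. S i - Y i" by (auto elim: eventually_elim2)
lift_definition times_ultrapower :: "('a, 'b) ultrapower \<Rightarrow> ('a, 'b) ultrapower \<Rightarrow> ('a, 'b) ultrapower"
  is "\<lambda>S Y i. S i * Y i" by (auto elim: eventually_elim2)
lift_definition divide_ultrapower :: "('a, 'b) ultrapower \<Rightarrow> ('a, 'b) ultrapower \<Rightarrow> ('a, 'b) ultrapower"
  is "\<lambda>S Y i. S i / Y i" by (auto elim: eventually_elim2)
lift_definition uminus_ultrapower :: "('a, 'b) ultrapower \<Rightarrow> ('a, 'b) ultrapower"
  is "\<lambda>S i. - S i" by (auto elim: eventually_mono)
lift_definition inverse_ultrapower :: "('a, 'b) ultrapower \<Rightarrow> ('a, 'b) ultrapower"
  is "\<lambda>S i. inverse (S i)" by (auto elim: eventually_mono)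

instance
proof
  show "(0 :: ('a, 'b) ultrapower) \<noteq> 1"
    by transfer (simp add: ultra(2) eventually_False)
  \<comment> \<open>For an ultrafilter, not being eventually zero means being eventually
    nonzero.\<close>
  show "inverse x * x = 1" if "x \<noteq> 0" for x :: "('a, 'b) ultrapower"
    using that by transfer (auto simp: not_eventually_ultra elim: eventually_mono)
qed (transfer; simp add: algebra_simps divide_inverse; fail)+

end

abbreviation ultra_class :: "('i set \<Rightarrow> 'a) \<Rightarrow> ('i, 'a) ultrapower" where
  "ultra_class \<equiv> abs_ultrapower"

lemma ultra_class_eq_iff: "ultra_class S = ultra_class Y \<longleftrightarrow> eventually (\<lambda>i. S i = Y i) ultra"
  by (rule ultrapower.abs_eq_iff)

lemma ultra_class_surj: "\<exists>S. s = ultra_class S"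
  by (rule exI[of _ "rep_ultrapower s"]) (simp add: Quotient_abs_rep[OF Quotient_ultrapower])

lemma ultra_class_hom:
  fixes S Y :: "'i set \<Rightarrow> 'a::field"
  shows "ultra_class (\<lambda>i. 0 :: 'a) = 0" "ultra_class (\<lambda>i. 1 :: 'a) = 1"
    "ultra_class (\<lambda>i. S i + Y i) = ultra_class S + ultra_class Y"
    "ultra_class (\<lambda>i. S i * Y i) = ultra_class S * ultra_class Y"
    "ultra_class (\<lambda>i. - S i) = - ultra_class S"
    "ultra_class (\<lambda>i. inverse (S i)) = inverse (ultra_class S)"
  by (simp_all add: zero_ultrapower.abs_eq one_ultrapower.abs_eq plus_ultrapower.abs_eq
      times_ultrapower.abs_eq uminus_ultrapower.abs_eq inverse_ultrapower.abs_eq)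

lemma ultra_class_eq_0: "ultra_class S = 0 \<longleftrightarrow> eventually (\<lambda>i. S i = (0::'a::field)) ultra"
  using ultra_class_eq_iff[of S "\<lambda>i. 0"] by (simp add: ultra_class_hom)

lemma ultra_class_sum: "ultra_class (\<lambda>i. \<Sum>x\<in>A. f x i :: 'a::field) = (\<Sum>x\<in>A. ultra_class (f x))"
  by (induction A rule: infinite_finite_induct) (auto simp: ultra_class_hom)

lemma ultra_class_prod: "ultra_class (\<lambda>i. \<Prod>x\<in>A. f x i :: 'a::field) = (\<Prod>x\<in>A. ultra_class (f x))"
  by (induction A rule: infinite_finite_induct) (auto simp: ultra_class_hom)

lemma ultra_class_power: "ultra_class (\<lambda>i. S i ^ n :: 'a::field) = ultra_class S ^ n"
  by (induction n) (auto simp: ultra_class_hom)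

lemma ultra_class_of_nat: "ultra_class (\<lambda>i. of_nat n :: 'a::field) = of_nat n"
  by (induction n) (auto simp: ultra_class_hom)

instance ultrapower :: (type, field_char_0) field_char_0
proof
  show "inj (of_nat :: nat \<Rightarrow> ('a, 'b) ultrapower)"
  proof (rule injI)
    fix m n :: nat assume "(of_nat m :: ('a, 'b) ultrapower) = of_nat n"
    hence "eventually (\<lambda>i. of_nat m = (of_nat n :: 'b)) (ultra :: 'a set filter)"
      by (simp only: ultra_class_eq_iff flip: ultra_class_of_nat)
    thus "m = n" by (cases "m = n") (auto simp: ultra(2))
  qed
qed

text \<open>Roots are chosen index by index wherever the leading coefficient is nonzero, which is
  the case at almost all indices.\<close>

instance ultrapower :: (type, alg_closed_field) alg_closed_field
proof intro_classes
  fix n :: nat and f :: "nat \<Rightarrow> ('a, 'b) ultrapower"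
  assume n: "n > 0" "f n \<noteq> 0"
  have "\<forall>k. \<exists>S. f k = ultra_class S" using ultra_class_surj by blast
  then obtain S where S: "\<And>k. f k = ultra_class (S k)" using choice[of "\<lambda>k S. f k = ultra_class S"] by blast
  have "\<exists>r. S n i \<noteq> 0 \<longrightarrow> (\<Sum>k\<le>n. S k i * r ^ k) = 0" for i
    using alg_closed[of n "\<lambda>k. S k i"] n(1) by auto
  then obtain r where r: "\<And>i. S n i \<noteq> 0 \<longrightarrow> (\<Sum>k\<le>n. S k i * r i ^ k) = 0" by metis
  have "eventually (\<lambda>i. S n i \<noteq> 0) ultra"
    using n(2) by (simp add: S ultra_class_eq_0 not_eventually_ultra)
  hence "eventually (\<lambda>i. (\<Sum>k\<le>n. S k i * r i ^ k) = 0) ultra"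
    by (rule eventually_mono) (use r in auto)
  hence "(\<Sum>k\<le>n. f k * ultra_class r ^ k) = 0"
    by (simp add: S ultra_class_sum ultra_class_hom ultra_class_power flip: ultra_class_eq_0)
  thus "\<exists>x. (\<Sum>k\<le>n. f k * x ^ k) = 0" by blast
qed

definition ultra_const :: "'a \<Rightarrow> ('i, 'a) ultrapower" where
  "ultra_const c = ultra_class (\<lambda>i. c)"

lemma ring_hom_map_ultra_const: "ring_hom_map (ultra_const :: 'a::field \<Rightarrow> ('i, 'a) ultrapower)"
  by standard (simp_all add: ultra_const_def ultra_class_hom)

text \<open>The part of Los's theorem that is used: a polynomial vanishes at a tuple of classes iff
  it vanishes at almost all indices.\<close>

lemma eval_ultrapower:
  fixes P :: "'a::field mpoly" and W :: "nat \<Rightarrow> 'i set \<Rightarrow> 'a"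
  shows "eval_hom ultra_const (\<lambda>k. ultra_class (W k)) P = ultra_class (\<lambda>i. eval_at (\<lambda>k. W k i) P)"
  by (simp add: eval_hom_def monomial_value_def ultra_class_sum ultra_class_hom ultra_class_prod
      ultra_class_power ultra_const_def)

section \<open>Descending to a subfield\<close>

text \<open>A polynomial identity holding at points with coordinates in \<open>K\<close> is preserved when a
  \<open>K\<close>-linear map onto \<open>K\<close> is applied to the coefficients. Such a map is the projection along
  a \<open>K\<close>-subspace that is maximal among those not containing \<open>c\<close>.\<close>

lemma linear_functional_exists:
  fixes K :: "'a::field set"
  assumes K: "subfield_set K" and c: "c \<noteq> 0"
  obtains \<pi> where "\<And>x y. \<pi> (x + y) = \<pi> x + \<pi> y" "\<And>x a. a \<in> K \<Longrightarrow> \<pi> (x * a) = \<pi> x * a"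
    "\<And>x. \<pi> x \<in> K" "\<pi> c \<noteq> 0"
proof -
  define \<W> where "\<W> = {W. 0 \<in> W \<and> (\<forall>x\<in>W. \<forall>y\<in>W. x + y \<in> W) \<and> (\<forall>x\<in>W. \<forall>a\<in>K. x * a \<in> W) \<and> c \<notin> W}"
  have "\<exists>M\<in>\<W>. \<forall>S\<in>\<W>. M \<subseteq> S \<longrightarrow> S = M"
  proof (rule subset_Zorn_nonempty)
    have "{0} \<in> \<W>" using c by (auto simp: \<W>_def)
    thus "\<W> \<noteq> {}" by blast
  next
    fix C assume C: "C \<noteq> {}" "subset.chain \<W> C"
    have CW: "W \<in> \<W>" if "W \<in> C" for W using C(2) that by (auto simp: subset_chain_def)
    have "x + y \<in> \<Union>C" if xy: "x \<in> \<Union>C" "y \<in> \<Union>C" for x y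
    proof -
      obtain S Y where XY: "S \<in> C" "Y \<in> C" "x \<in> S" "y \<in> Y" using xy by blast
      hence "S \<subseteq> Y \<or> Y \<subseteq> S" using C(2) by (auto simp: subset_chain_def)
      then obtain Z where "Z \<in> C" "x \<in> Z" "y \<in> Z" using XY by blast
      thus ?thesis using CW[of Z] by (auto simp: \<W>_def)
    qed
    moreover have "x * a \<in> \<Union>C" if "x \<in> \<Union>C" "a \<in> K" for x a
      using that CW unfolding \<W>_def by blast
    moreover have "0 \<in> \<Union>C" "c \<notin> \<Union>C" using C(1) CW unfolding \<W>_def by blast+
    ultimately show "\<Union>C \<in> \<W>" unfolding \<W>_def by blast
  qed
  then obtain W where W: "W \<in> \<W>" and max: "\<And>S. S \<in> \<W> \<Longrightarrow> W \<subseteq> S \<Longrightarrow> S = W" by blast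
  have W0: "0 \<in> W" and Wadd: "\<And>x y. x \<in> W \<Longrightarrow> y \<in> W \<Longrightarrow> x + y \<in> W"
    and Wmult: "\<And>x a. x \<in> W \<Longrightarrow> a \<in> K \<Longrightarrow> x * a \<in> W" and Wc: "c \<notin> W"
    using W by (auto simp: \<W>_def)
  have Wminus: "- x \<in> W" if "x \<in> W" for x
    using Wmult[OF that subfield_setD(5)[OF K subfield_setD(2)[OF K]]] by simp
  have Wdiff: "x - y \<in> W" if "x \<in> W" "y \<in> W" for x y
    using Wadd[OF that(1) Wminus[OF that(2)]] by simp
  have ex: "\<exists>a\<in>K. x - a * c \<in> W" for x
  proof (cases "x \<in> W")
    case True
    thus ?thesis using subfield_setD(1)[OF K] by (intro bexI[of _ 0]) auto
  next
    case False
    \<comment> \<open>\<open>W\<close> enlarged by the multiples of \<open>x\<close>. As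
      \<open>S\<close> properly contains \<open>W\<close>, it must contain \<open>c\<close>; solving
      for \<open>x\<close> then gives the coefficient of \<open>c\<close>.\<close>
    define S where "S = {w + x * a |w a. w \<in> W \<and> a \<in> K}"
    have "W \<subseteq> S"
    proof
      fix w assume "w \<in> W"
      thus "w \<in> S" unfolding S_def using subfield_setD(1)[OF K]
        by (intro CollectI exI[of _ w] exI[of _ 0]) auto
    qed
    moreover have "x \<in> S" unfolding S_def using W0 subfield_setD(2)[OF K]
      by (intro CollectI exI[of _ 0] exI[of _ 1]) auto
    ultimately have "S \<notin> \<W>" using max[of S] False by blast
    moreover have "0 \<in> S" using W0 \<open>W \<subseteq> S\<close> by blast
    moreover have "u + v \<in> S" if uv: "u \<in> S" "v \<in> S" for u v
    proof -
      obtain w a w' a' where "u = w + x * a" "v = w' + x * a'" "w \<in> W" "w' \<in> W" "a \<in> K" "a' \<in> K"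
        using uv unfolding S_def by blast
      thus ?thesis unfolding S_def using Wadd subfield_setD(3)[OF K]
        by (intro CollectI exI[of _ "w + w'"] exI[of _ "a + a'"]) (auto simp: algebra_simps)
    qed
    moreover have "u * b \<in> S" if ub: "u \<in> S" "b \<in> K" for u b
    proof -
      obtain w a where "u = w + x * a" "w \<in> W" "a \<in> K" using ub unfolding S_def by blast
      thus ?thesis unfolding S_def using ub Wmult subfield_setD(4)[OF K]
        by (intro CollectI exI[of _ "w * b"] exI[of _ "a * b"]) (auto simp: distrib_right mult.assoc)
    qed
    ultimately have "c \<in> S" unfolding \<W>_def by blast
    then obtain w a where wa: "c = w + x * a" "w \<in> W" "a \<in> K" unfolding S_def by blast
    have "a \<noteq> 0" using wa Wc by auto
    hence "x - inverse a * c = - (w * inverse a)" by (simp add: wa(1) field_simps)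
    thus ?thesis using wa Wmult Wminus subfield_setD(6)[OF K] by metis
  qed
  have unique: "a = b" if "a \<in> K" "b \<in> K" "x - a * c \<in> W" "x - b * c \<in> W" for a b x
  proof (rule ccontr)
    assume "a \<noteq> b"
    have W: "(a - b) * c \<in> W" using Wdiff[OF that(4,3)] by (simp add: algebra_simps)
    have "(a - b) * c * inverse (a - b) \<in> W"
      using that by (intro Wmult[OF W]) (auto intro: subfield_setD(6,7)[OF K])
    moreover have "(a - b) * c * inverse (a - b) = c" using \<open>a \<noteq> b\<close> by (simp add: field_simps)
    ultimately show False using Wc by simp
  qed
  \<comment> \<open>The field is the direct sum of \<open>W\<close> and the \<open>K\<close>-line
    through \<open>c\<close>, and \<open>\<pi>\<close> is the coordinate along
    \<open>c\<close>.\<close>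
  define \<pi> where "\<pi> x = (THE a. a \<in> K \<and> x - a * c \<in> W)" for x
  have \<pi>I: "\<pi> x = a" if "a \<in> K" "x - a * c \<in> W" for a x
    unfolding \<pi>_def using that unique by blast
  have \<pi>: "\<pi> x \<in> K" "x - \<pi> x * c \<in> W" for x
    using ex[of x] \<pi>I by metis+
  show thesis
  proof (rule that)
    show "\<pi> (x + y) = \<pi> x + \<pi> y" for x y
      using Wadd[OF \<pi>(2)[of x] \<pi>(2)[of y]] subfield_setD(3)[OF K \<pi>(1) \<pi>(1)]
      by (intro \<pi>I) (auto simp: algebra_simps)
    show "\<pi> (x * a) = \<pi> x * a" if "a \<in> K" for x a
      using Wmult[OF \<pi>(2)[of x] that] subfield_setD(4)[OF K \<pi>(1)[of x] that]
      by (intro \<pi>I) (auto simp: algebra_simps)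
    show "\<pi> x \<in> K" for x by (rule \<pi>)
    have "\<pi> c = 1" using W0 subfield_setD(2)[OF K] by (intro \<pi>I) auto
    thus "\<pi> c \<noteq> 0" by simp
  qed
qed

text \<open>Monomials take values in \<open>K\<close> at the points \<open>W k i\<close>, so a
  \<open>K\<close>-linear \<open>\<pi>\<close> commutes with evaluation there. It is chosen nonzero
  on one coefficient of \<open>P\<close>, which keeps the new polynomial nonzero.\<close>

lemma descent_to_subfield:
  fixes P :: "'a::field mpoly" and W :: "nat \<Rightarrow> 'i set \<Rightarrow> 'a"
  assumes K: "subfield_set K" and P: "P \<in> mpolys UNIV V" "P \<noteq> 0"
    "eval_hom ultra_const (\<lambda>k. ultra_class (W k)) P = 0"
    and W: "\<And>k i. k \<in> V \<Longrightarrow> W k i \<in> K"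
  shows "\<exists>P'\<in>mpolys K V. P' \<noteq> 0 \<and> eval_hom ultra_const (\<lambda>k. ultra_class (W k)) P' = 0 \<and> keys P' \<subseteq> keys P"
proof -
  obtain m0 where "lookup P m0 \<noteq> 0" using P(2) poly_mapping_eqI[of P 0] by auto
  then obtain \<pi> where add: "\<And>x y. \<pi> (x + y) = \<pi> x + \<pi> y" and scale: "\<And>x a. a \<in> K \<Longrightarrow> \<pi> (x * a) = \<pi> x * a"
    and range: "\<And>x. \<pi> x \<in> K" and nz: "\<pi> (lookup P m0) \<noteq> 0"
    using linear_functional_exists[OF K] by metis
  have \<pi>0: "\<pi> 0 = 0" using scale[of 0 0] subfield_setD(1)[OF K] by simp
  have \<pi>sum: "\<pi> (sum f I) = (\<Sum>i\<in>I. \<pi> (f i))" for f and I :: "(nat \<Rightarrow>\<^sub>0 nat) set"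
    by (induction I rule: infinite_finite_induct) (auto simp: \<pi>0 add)
  define P' where "P' = Poly_Mapping.map \<pi> P"
  have look: "lookup P' m = \<pi> (lookup P m)" for m
    by (simp add: P'_def Poly_Mapping.map.rep_eq when_def \<pi>0)
  have keys: "keys P' \<subseteq> keys P" using \<pi>0 by (auto simp: in_keys_iff look)
  have P'V: "P' \<in> mpolys K V" using keys P(1) range by (auto simp: mpolys_def look)
  have eval: "eval_at v P' = \<pi> (eval_at v P)" if "\<And>k. k \<in> V \<Longrightarrow> v k \<in> K" for v
  proof -
    have mon: "monomial_value v m \<in> K" if "m \<in> keys P" for m
      unfolding monomial_value_def using that P(1) \<open>\<And>k. k \<in> V \<Longrightarrow> v k \<in> K\<close>
      by (intro subfield_set_prod subfield_set_power K) (auto simp: mpolys_def dest!: bspec subsetD)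
    have "eval_at v P' = (\<Sum>m\<in>keys P. lookup P' m * monomial_value v m)"
      by (rule ring_hom_map.eval_superset[OF ring_hom_map_id]) (use keys in auto)
    also have "\<dots> = \<pi> (eval_at v P)"
      unfolding eval_hom_def \<pi>sum by (intro sum.cong refl) (simp add: scale mon look)
    finally show ?thesis .
  qed
  have "eventually (\<lambda>i. eval_at (\<lambda>k. W k i) P = 0) ultra"
    using P(3) by (simp add: eval_ultrapower ultra_class_eq_0)
  hence "eventually (\<lambda>i. eval_at (\<lambda>k. W k i) P' = 0) ultra"
    by (rule eventually_mono) (simp add: eval[OF W] \<pi>0)
  hence "eval_hom ultra_const (\<lambda>k. ultra_class (W k)) P' = 0"
    by (simp add: eval_ultrapower ultra_class_eq_0)
  moreover have "P' \<noteq> 0" using nz look[of m0] by auto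
  ultimately show ?thesis using P'V keys by blast
qed

section \<open>Primitive elements\<close>

inductive_set field_gen :: "'k::field set \<Rightarrow> 'k set" for S where
  base: "a \<in> S \<Longrightarrow> a \<in> field_gen S"
| one: "1 \<in> field_gen S"
| add: "a \<in> field_gen S \<Longrightarrow> b \<in> field_gen S \<Longrightarrow> a + b \<in> field_gen S"
| mult: "a \<in> field_gen S \<Longrightarrow> b \<in> field_gen S \<Longrightarrow> a * b \<in> field_gen S"
| minus: "a \<in> field_gen S \<Longrightarrow> - a \<in> field_gen S"
| inverse: "a \<in> field_gen S \<Longrightarrow> inverse a \<in> field_gen S"

lemma subfield_set_field_gen: "subfield_set (field_gen S)"
proof -
  have "1 + - 1 \<in> field_gen S" by (intro field_gen.intros)
  thus ?thesis unfolding subfield_set_def by (auto intro: field_gen.intros)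
qed

lemma field_gen_least:
  assumes "subfield_set K" "S \<subseteq> K"
  shows "field_gen S \<subseteq> K"
proof
  fix a assume "a \<in> field_gen S"
  thus "a \<in> K" by induction (use assms in \<open>auto intro: subfield_setD[OF assms(1)]\<close>)
qed

definition algebraic_over :: "'k::field set \<Rightarrow> 'k \<Rightarrow> bool" where
  "algebraic_over K \<beta> \<longleftrightarrow> (\<exists>p. p \<noteq> 0 \<and> (\<forall>k. coeff p k \<in> K) \<and> poly p \<beta> = 0)"

lemma coeff_mult_in_subfield:
  assumes "subfield_set K" "\<And>k. coeff p k \<in> K" "\<And>k. coeff q k \<in> K"
  shows "coeff (p * q) k \<in> K"
  unfolding coeff_mult using assms by (intro subfield_set_sum subfield_setD(4)) auto

lemma coeff_pcompose_in_subfield: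
  assumes K: "subfield_set K" and "\<And>k. coeff p k \<in> K" and q: "\<And>k. coeff q k \<in> K"
  shows "coeff (pcompose p q) k \<in> K"
  using assms(2)
proof (induction p arbitrary: k)
  case 0
  thus ?case using subfield_setD(1)[OF K] by simp
next
  case (pCons a p)
  have p: "coeff p k \<in> K" for k using pCons.prems[of "Suc k"] by simp
  have "a \<in> K" using pCons.prems[of 0] by simp
  hence "coeff [:a:] k \<in> K" using subfield_setD(1)[OF K] by (auto simp: coeff_pCons split: nat.splits)
  moreover have "coeff (q * pcompose p q) k \<in> K"
    using pCons.IH p q by (intro coeff_mult_in_subfield K) auto
  ultimately show ?case by (simp add: pcompose_pCons subfield_setD(3)[OF K])
qed

text \<open>The greatest common divisor of \<open>f (\<theta> - c X)\<close> and \<open>g\<close> has coefficients in any field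
  containing \<open>K\<close> and \<open>\<theta>\<close>, and it is linear with root \<open>\<beta>\<close>.\<close>

lemma primitive_element:
  fixes \<alpha> \<beta> :: "'k::{alg_closed_field, field_char_0}"
  assumes K: "subfield_set K" and \<alpha>: "algebraic_over K \<alpha>" and \<beta>: "algebraic_over K \<beta>"
  shows "\<exists>c :: nat. \<forall>M. subfield_set M \<longrightarrow> K \<subseteq> M \<longrightarrow> \<alpha> + of_nat c * \<beta> \<in> M \<longrightarrow> \<beta> \<in> M"
proof -
  obtain f where f: "f \<noteq> 0" "\<And>k. coeff f k \<in> K" "poly f \<alpha> = 0"
    using \<alpha> by (auto simp: algebraic_over_def)
  define G where "G = {g. g \<noteq> 0 \<and> (\<forall>k. coeff g k \<in> K) \<and> poly g \<beta> = 0}"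
  have "\<exists>g. g \<in> G" using \<beta> by (auto simp: algebraic_over_def G_def)
  \<comment> \<open>Up to a scalar, \<open>g\<close> is the minimal polynomial of
    \<open>\<beta>\<close> over \<open>K\<close>.\<close>
  then obtain g where g: "g \<in> G" and gmin: "\<And>q. q \<in> G \<Longrightarrow> Polynomial.degree g \<le> Polynomial.degree q"
    using ex_has_least_nat[of "\<lambda>g. g \<in> G" _ Polynomial.degree] by blast
  have g0: "g \<noteq> 0" "\<And>k. coeff g k \<in> K" "poly g \<beta> = 0" using g by (auto simp: G_def)
  have gdeg: "Polynomial.degree g > 0"
  proof (rule ccontr)
    assume "\<not> Polynomial.degree g > 0"
    then obtain a where "g = [:a:]" by (metis degree_eq_zeroE neq0_conv)
    thus False using g0 by simp
  qed
  \<comment> \<open>In characteristic zero the derivative is nonzero of smaller degree, so by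
    minimality of \<open>g\<close> it cannot vanish at \<open>\<beta>\<close>.\<close>
  have simple: "poly (pderiv g) \<beta> \<noteq> 0"
  proof
    assume "poly (pderiv g) \<beta> = 0"
    moreover have "pderiv g \<noteq> 0" using gdeg by (simp add: pderiv_eq_0_iff)
    moreover have "coeff (pderiv g) k \<in> K" for k
      unfolding coeff_pderiv using g0 by (intro subfield_setD(4)[OF K] subfield_set_of_nat[OF K])
    ultimately have "pderiv g \<in> G" by (simp add: G_def)
    from gmin[OF this] show False using gdeg by (simp add: degree_pderiv)
  qed
  \<comment> \<open>For \<open>c\<close> outside this set, no root \<open>b\<close> of
    \<open>g\<close> other than \<open>\<beta>\<close> makes
    \<open>\<alpha> + c * \<beta> - c * b\<close> a root \<open>a\<close> of
    \<open>f\<close>.\<close>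
  let ?bad = "(\<lambda>(a, b). (a - \<alpha>) / (\<beta> - b)) ` ({x. poly f x = 0} \<times> {x. poly g x = 0})"
  have "finite ?bad" using f g0 by (intro finite_imageI finite_cartesian_product poly_roots_finite)
  moreover have "infinite (range (of_nat :: nat \<Rightarrow> 'k))" by (simp add: range_inj_infinite inj_of_nat)
  ultimately obtain c :: nat where c: "of_nat c \<notin> ?bad"
    by (metis finite_subset image_subsetI)
  show ?thesis
  proof (intro exI[of _ c] allI impI)
    fix M assume M: "subfield_set M" and KM: "K \<subseteq> M" and \<theta>: "\<alpha> + of_nat c * \<beta> \<in> M"
    define F where "F = pcompose f [:\<alpha> + of_nat c * \<beta>, - of_nat c:]"
    have "coeff [:\<alpha> + of_nat c * \<beta>, - of_nat c:] k \<in> M" for k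
      using \<theta> subfield_set_of_nat[OF M] subfield_setD(1,5)[OF M]
      by (auto simp: coeff_pCons split: nat.splits)
    hence FM: "coeff F k \<in> M" for k
      unfolding F_def using f KM by (intro coeff_pcompose_in_subfield M) auto
    have gM: "coeff g k \<in> M" for k using g0 KM by auto
    \<comment> \<open>The ideal generated by \<open>F\<close> and \<open>g\<close> over
      \<open>M\<close>. Its nonzero element \<open>d\<close> of least degree is their greatest
      common divisor.\<close>
    define J where "J = {u * F + v * g |u v. (\<forall>k. coeff u k \<in> M) \<and> (\<forall>k. coeff v k \<in> M)}"
    have JM: "coeff p k \<in> M" if "p \<in> J" for p k
      using that unfolding J_def
      by (auto intro!: subfield_setD(3)[OF M] coeff_mult_in_subfield[OF M] FM gM)
    have const: "coeff [:a:] k \<in> M" if "a \<in> M" for a k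
      using that subfield_setD(1)[OF M] by (auto simp: coeff_pCons split: nat.splits)
    have FJ: "F \<in> J" unfolding J_def using const[OF subfield_setD(2)[OF M]] const[OF subfield_setD(1)[OF M]]
      by (intro CollectI exI[of _ "[:1:]"] exI[of _ "[:0:]"]) auto
    have gJ: "g \<in> J" unfolding J_def using const[OF subfield_setD(2)[OF M]] const[OF subfield_setD(1)[OF M]]
      by (intro CollectI exI[of _ "[:0:]"] exI[of _ "[:1:]"]) auto
    have "\<exists>d. d \<in> J \<and> d \<noteq> 0" using gJ g0 by blast
    then obtain d where d: "d \<in> J" "d \<noteq> 0"
      and dmin: "\<And>q. q \<in> J \<Longrightarrow> q \<noteq> 0 \<Longrightarrow> Polynomial.degree d \<le> Polynomial.degree q"
      using ex_has_least_nat[of "\<lambda>d. d \<in> J \<and> d \<noteq> 0" _ Polynomial.degree] by blast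
    have dvd: "d dvd p" if pJ: "p \<in> J" for p
    proof -
      obtain N q r where qr: "smult (lead_coeff d ^ N) p = d * q + r" "\<forall>k. coeff q k \<in> M"
        "r = 0 \<or> Polynomial.degree r < Polynomial.degree d"
        using pseudo_division[of M d p, OF _ _ _ d(2) JM[OF d(1)] JM[OF pJ]] subfield_setD[OF M] by blast
      define l where "l = lead_coeff d ^ N"
      have l: "l \<in> M" "l \<noteq> 0" using JM[OF d(1)] d(2) by (auto simp: l_def intro: subfield_set_power[OF M])
      obtain u v where p: "p = u * F + v * g" "\<forall>k. coeff u k \<in> M" "\<forall>k. coeff v k \<in> M"
        using \<open>p \<in> J\<close> unfolding J_def by blast
      obtain u' v' where d': "d = u' * F + v' * g" "\<forall>k. coeff u' k \<in> M" "\<forall>k. coeff v' k \<in> M"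
        using d(1) unfolding J_def by blast
      have "r = (smult l u - u' * q) * F + (smult l v - v' * q) * g"
        using qr(1) unfolding l_def[symmetric] by (simp add: p(1) d'(1) algebra_simps smult_add_right)
      moreover have "coeff (smult l u - u' * q) k \<in> M" "coeff (smult l v - v' * q) k \<in> M" for k
        using p(2,3) d'(2,3) qr(2) l
        by (auto intro!: subfield_setD(4,7)[OF M] coeff_mult_in_subfield[OF M])
      ultimately have "r \<in> J" unfolding J_def by blast
      hence "r = 0" using qr(3) dmin[of r] by fastforce
      hence "d dvd smult l p" using qr(1) by (simp add: l_def)
      thus ?thesis using l by (simp add: dvd_smult_iff)
    qed
    have d\<beta>: "poly d \<beta> = 0"
    proof -
      have "poly F \<beta> = 0" using f by (simp add: F_def poly_pcompose algebra_simps)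
      thus ?thesis using d(1) g0 unfolding J_def by auto
    qed
    have root: "x = \<beta>" if "poly d x = 0" for x
    proof (rule ccontr)
      assume "x \<noteq> \<beta>"
      have "poly F x = 0" "poly g x = 0" using dvd[OF FJ] dvd[OF gJ] that by (auto simp: dvd_def)
      hence "(\<alpha> + of_nat c * \<beta> - of_nat c * x, x) \<in> {x. poly f x = 0} \<times> {x. poly g x = 0}"
        by (simp add: F_def poly_pcompose algebra_simps)
      moreover have "of_nat c = (\<alpha> + of_nat c * \<beta> - of_nat c * x - \<alpha>) / (\<beta> - x)"
        using \<open>x \<noteq> \<beta>\<close> by (simp add: field_simps)
      ultimately show False using c by (auto simp: image_iff)
    qed
    obtain d1 where d1: "d = [:- \<beta>, 1:] * d1" using d\<beta> by (metis poly_eq_0_iff_dvd dvd_def)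
    \<comment> \<open>A further root of \<open>d\<close> could only be \<open>\<beta>\<close> again,
      which would make \<open>\<beta>\<close> a double root of \<open>g\<close>, against
      \<open>simple\<close>.\<close>
    have "Polynomial.degree d1 = 0"
    proof (rule ccontr)
      assume "Polynomial.degree d1 \<noteq> 0"
      then obtain x where "poly d1 x = 0" using alg_closed_imp_poly_has_root[of d1] by auto
      hence "poly d1 \<beta> = 0" using root[of x] d1 by auto
      moreover obtain q where "g = d * q" using dvd[OF gJ] by (auto simp: dvd_def)
      moreover have "pderiv d = [:- \<beta>, 1:] * pderiv d1 + d1 * pderiv [:- \<beta>, 1:]"
        unfolding d1 by (rule pderiv_mult)
      hence "poly (pderiv d) \<beta> = 0" using calculation(1) by (simp only: poly_add poly_mult) simp
      ultimately show False using simple d\<beta> by (simp add: pderiv_mult)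
    qed
    then obtain a where "d1 = [:a:]" by (metis degree_eq_zeroE)
    hence "a \<noteq> 0" "coeff d 1 = a" "coeff d 0 = - \<beta> * a" using d(2) d1 by auto
    hence "\<beta> = - coeff d 0 / coeff d 1" by simp
    also have "\<dots> \<in> M" using JM[OF d(1)] by (intro subfield_setD(5,8)[OF M])
    finally show "\<beta> \<in> M" .
  qed
qed

text \<open>Induction on the generation of \<open>s\<close>: fractions are added and multiplied over
  the product of their denominators, and \<open>inverse 0 = 0\<close> is the fraction
  \<open>0 / 1\<close>.\<close>

lemma field_gen_fraction:
  fixes h :: "'a::field \<Rightarrow> 'k::field"
  assumes hom: "ring_hom_map h" and K: "subfield_set K" and "s \<in> field_gen (h ` K \<union> w ` V)"
  shows "\<exists>p\<in>mpolys K V. \<exists>q\<in>mpolys K V. eval_hom h w q \<noteq> 0 \<and> s * eval_hom h w q = eval_hom h w p"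
  using assms(3)
proof induction
  case (base a)
  interpret ring_hom_map h by fact
  have "\<exists>p\<in>mpolys K V. a = eval_hom h w p"
  proof (cases "a \<in> h ` K")
    case True
    then obtain c where "c \<in> K" "a = h c" by blast
    thus ?thesis by (intro bexI[of _ "Poly_Mapping.single 0 c"]) (auto intro: mpolys_single K)
  next
    case False
    then obtain k where "k \<in> V" "a = w k" using base by blast
    thus ?thesis by (intro bexI[of _ "mvar k"]) (auto intro: mpolys_closed K)
  qed
  thus ?case using mpolys_closed(2)[OF K, of V] by (metis eval_1 mult.right_neutral zero_neq_one)
next
  case one
  interpret ring_hom_map h by fact
  show ?case using mpolys_closed(2)[OF K, of V] by (intro bexI[of _ 1]) auto
next
  case (add a b)
  interpret ring_hom_map h by fact
  from add.IH obtain p q p' q' where pq: "p \<in> mpolys K V" "q \<in> mpolys K V" "p' \<in> mpolys K V" "q' \<in> mpolys K V"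
    "eval_hom h w q \<noteq> 0" "a * eval_hom h w q = eval_hom h w p"
    "eval_hom h w q' \<noteq> 0" "b * eval_hom h w q' = eval_hom h w p'" by blast
  have "(a + b) * eval_hom h w (q * q') = (a * eval_hom h w q) * eval_hom h w q' + (b * eval_hom h w q') * eval_hom h w q"
    by (simp add: eval_mult algebra_simps)
  hence "(a + b) * eval_hom h w (q * q') = eval_hom h w (p * q' + p' * q)"
    by (simp add: pq eval_add eval_mult)
  moreover have "eval_hom h w (q * q') \<noteq> 0" using pq by (simp add: eval_mult)
  moreover have "p * q' + p' * q \<in> mpolys K V" "q * q' \<in> mpolys K V"
    using pq by (auto intro: mpolys_closed K)
  ultimately show ?case by blast
next
  case (mult a b)
  interpret ring_hom_map h by fact
  from mult.IH obtain p q p' q' where pq: "p \<in> mpolys K V" "q \<in> mpolys K V" "p' \<in> mpolys K V" "q' \<in> mpolys K V"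
    "eval_hom h w q \<noteq> 0" "a * eval_hom h w q = eval_hom h w p"
    "eval_hom h w q' \<noteq> 0" "b * eval_hom h w q' = eval_hom h w p'" by blast
  have "a * b * eval_hom h w (q * q') = (a * eval_hom h w q) * (b * eval_hom h w q')"
    by (simp add: eval_mult algebra_simps)
  hence "a * b * eval_hom h w (q * q') = eval_hom h w (p * p')"
    by (simp add: pq eval_mult)
  moreover have "eval_hom h w (q * q') \<noteq> 0" using pq by (simp add: eval_mult)
  moreover have "p * p' \<in> mpolys K V" "q * q' \<in> mpolys K V"
    using pq by (auto intro: mpolys_closed K)
  ultimately show ?case by blast
next
  case (minus a)
  interpret ring_hom_map h by fact
  from minus.IH obtain p q where "p \<in> mpolys K V" "q \<in> mpolys K V"
    "eval_hom h w q \<noteq> 0" "a * eval_hom h w q = eval_hom h w p" by blast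
  thus ?case
    by (intro bexI[of _ "- p"] bexI[of _ q] mpolys_closed K) (auto simp: eval_minus)
next
  case (inverse a)
  interpret ring_hom_map h by fact
  show ?case
  proof (cases "a = 0")
    case True
    thus ?thesis using mpolys_closed(1,2)[OF K, of V] by (intro bexI[of _ 0] bexI[of _ 1]) auto
  next
    case False
    from inverse.IH obtain p q where "p \<in> mpolys K V" "q \<in> mpolys K V"
      "eval_hom h w q \<noteq> 0" "a * eval_hom h w q = eval_hom h w p" by blast
    thus ?thesis using False
      by (intro bexI[of _ q] bexI[of _ p]) (auto simp: field_simps)
  qed
qed

section \<open>Specialising formulas at a generic point\<close>

lemma subfield_imp_subfield_set:
  fixes L :: "'a::field set"
  assumes "subfield L ring_of_type_algebra"
  shows "subfield_set L"
proof -
  let ?R = "ring_of_type_algebra :: 'a ring"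
  interpret R: field ?R by (rule field_from_type_algebra)
  have ops: "x \<otimes>\<^bsub>?R\<^esub> y = x * y" "x \<oplus>\<^bsub>?R\<^esub> y = x + y" "\<one>\<^bsub>?R\<^esub> = 1" "\<zero>\<^bsub>?R\<^esub> = 0" "carrier ?R = UNIV" for x y
    by (auto simp: ring_of_type_algebra_def)
  note sub = subringE[OF subfieldE(1)[OF assms]]
  have minus: "- a \<in> L" if "a \<in> L" for a
  proof -
    have "\<ominus>\<^bsub>?R\<^esub> a = - a" by (rule R.minus_equality) (simp_all add: ops)
    thus ?thesis using sub(5)[OF that] by simp
  qed
  have inv: "inverse a \<in> L" if "a \<in> L" for a
  proof (cases "a = 0")
    case True
    thus ?thesis using sub(2) by (simp add: ops)
  next
    case False
    have "inv\<^bsub>?R\<^esub> a = inverse a" using False by (intro R.comm_inv_char) (simp_all add: ops)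
    thus ?thesis using R.subfield_m_inv(1)[OF assms, of a] that False by (simp add: ops)
  qed
  show ?thesis unfolding subfield_set_def
    using sub(2,3,6,7) minus inv by (simp add: ops)
qed

text \<open>An exponent supported on \<open>{0}\<close> is determined by its value at
  \<open>0\<close>, so no terms merge in the passage to a univariate polynomial, which is therefore
  nonzero.\<close>

lemma finite_zeros_univariate:
  fixes P :: "'a::field mpoly"
  assumes P: "P \<in> mpolys UNIV {0}" "P \<noteq> 0"
  shows "finite {c. eval_at (\<lambda>_. c) P = 0}"
proof -
  define p where "p = (\<Sum>m\<in>keys P. Polynomial.monom (lookup P m) (lookup m 0))"
  have mon: "monomial_value (\<lambda>_. c) m = c ^ lookup m 0" if "m \<in> keys P" for c :: 'a and m
    using monomial_value_superset[of "{0}" m "\<lambda>_. c"] P(1) that by (auto simp: mpolys_def)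
  have "eval_at (\<lambda>_. c) P = poly p c" for c
    unfolding eval_hom_def p_def poly_sum poly_monom by (intro sum.cong) (auto simp: mon)
  moreover have "p \<noteq> 0"
  proof -
    obtain m where m: "m \<in> keys P" using P(2) wdeg_attained by blast
    have eq: "k = m" if "k \<in> keys P" "lookup k 0 = lookup m 0" for k
    proof (rule poly_mapping_eqI)
      fix i
      have "keys k \<subseteq> {0}" "keys m \<subseteq> {0}" using P(1) m that(1) by (auto simp: mpolys_def)
      hence "i \<notin> keys k" "i \<notin> keys m" if "i \<noteq> 0" using that by auto
      thus "lookup k i = lookup m i" using that(2) by (cases "i = 0") (auto simp: in_keys_iff)
    qed
    have "coeff p (lookup m 0) = (\<Sum>k\<in>keys P. if k = m then lookup P k else 0)"
      unfolding p_def coeff_sum coeff_monom by (intro sum.cong) (use eq in auto)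
    also have "\<dots> = lookup P m" using m by simp
    finally show ?thesis using m by (auto simp: in_keys_iff)
  qed
  ultimately show ?thesis by (simp add: poly_roots_finite)
qed

lemma val_cong: "(\<And>i. i \<in> vars_term s \<Longrightarrow> v i = v' i) \<Longrightarrow> val v s = val v' s"
  by (induction s) auto

lemma sat_cong: "(\<And>i. i \<in> vars \<phi> \<Longrightarrow> v i = v' i) \<Longrightarrow> sat v \<phi> = sat v' \<phi>"
proof (induction \<phi>)
  case (FEq s t)
  thus ?case using val_cong[of s v v'] val_cong[of t v v'] by simp
qed auto

text \<open>An ultrafilter that contains a finite union contains one of its members.\<close>

lemma ultra_finite_image:
  fixes x :: "'i set \<Rightarrow> 'a"
  assumes "finite S" "eventually (\<lambda>i. x i \<in> S) ultra"
  shows "\<exists>c\<in>S. eventually (\<lambda>i. x i = c) ultra"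
proof (rule ccontr)
  assume none: "\<not> ?thesis"
  have "eventually (\<lambda>i. x i \<noteq> c) ultra" if "c \<in> S" for c
  proof -
    have "\<not> eventually (\<lambda>i. x i = c) ultra" using none that by blast
    thus ?thesis by (simp only: not_eventually_ultra)
  qed
  hence "eventually (\<lambda>i. \<forall>c\<in>S. x i \<noteq> c) ultra" using assms(1) by (intro eventually_ball_finite) auto
  hence "eventually (\<lambda>i. False) (ultra :: 'i set filter)"
    using assms(2) by (rule eventually_elim2) blast
  thus False by (simp add: eventually_False ultra(2))
qed

text \<open>In the application \<open>N k / D k\<close> expresses witness \<open>k\<close> as a
  rational function of \<open>w\<close>, and \<open>specialise v\<close> puts another point
  \<open>v\<close> into these functions. Index \<open>0\<close> remains \<open>X\<close>, so witness
  \<open>k\<close> is the variable \<open>k + 1\<close>.\<close>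

locale generic_point =
  fixes h :: "'a::field \<Rightarrow> 'k::field" and w :: "nat \<Rightarrow> 'k"
    and L :: "'a set" and V :: "nat set" and N D :: "nat \<Rightarrow> 'a mpoly" and n :: nat
  assumes hom: "ring_hom_map h" and L: "subfield_set L" and V0: "0 \<in> V"
    and ND: "\<And>k. k < n \<Longrightarrow> N k \<in> mpolys L V" "\<And>k. k < n \<Longrightarrow> D k \<in> mpolys L V"
    and D0: "\<And>k. k < n \<Longrightarrow> eval_hom h w (D k) \<noteq> 0"
begin

sublocale ring_hom_map h by (rule hom)

abbreviation specialise :: "(nat \<Rightarrow> 'a) \<Rightarrow> nat \<Rightarrow> 'a" where
  "specialise v \<equiv> case_nat (v 0) (\<lambda>k. eval_at v (N k) / eval_at v (D k))"

text \<open>\<open>p / q\<close> is the term as a rational function of the point, with the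
  denominator multiplied out.\<close>

definition represents :: "'a mpoly \<Rightarrow> 'a mpoly \<Rightarrow> 'a rterm \<Rightarrow> bool" where
  "represents p q s \<longleftrightarrow> p \<in> mpolys L V \<and> q \<in> mpolys L V \<and> eval_hom h w q \<noteq> 0 \<and>
     (\<forall>v. (\<forall>k<n. eval_at v (D k) \<noteq> 0) \<longrightarrow>
        eval_at v q \<noteq> 0 \<and> val (specialise v) s * eval_at v q = eval_at v p)"

lemma term_fraction:
  assumes "params_term s \<subseteq> L" "vars_term s \<subseteq> {..n}"
  shows "\<exists>p q. represents p q s"
  using assms
proof (induction s)
  case (TVar i)
  show ?case
  proof (cases i)
    case 0
    have "represents (mvar 0) 1 (TVar i)"
      using V0 by (simp add: 0 represents_def mpolys_closed[OF L])
    thus ?thesis by blast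
  next
    case (Suc k)
    have "represents (N k) (D k) (TVar i)"
      using TVar ND D0 by (simp add: Suc represents_def)
    thus ?thesis by blast
  qed
next
  case (TParam a)
  hence "represents (Poly_Mapping.single 0 a) 1 (TParam a)"
    by (simp add: represents_def mpolys_closed[OF L] mpolys_single[OF L])
  thus ?case by blast
next
  case TZero
  have "represents 0 1 TZero" by (simp add: represents_def mpolys_closed[OF L])
  thus ?case by blast
next
  case TOne
  have "represents 1 1 TOne" by (simp add: represents_def mpolys_closed[OF L])
  thus ?case by blast
next
  case (TNeg s)
  then obtain p q where "represents p q s" by auto
  hence "represents (- p) q (TNeg s)"
    by (simp add: represents_def mpolys_closed[OF L] eval_at_minus)
  thus ?case by blast
next
  case (TAdd s t)
  then obtain p q p' q' where r: "represents p q s" "represents p' q' t" by auto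
  have eq: "(a + b) * (c * d) = a * c * d + b * d * c" for a b c d :: 'a by (simp add: algebra_simps)
  have "represents (p * q' + p' * q) (q * q') (TAdd s t)"
    using r unfolding represents_def eval_at_add eval_at_mult eval_mult val.simps eq
    by (simp add: mpolys_closed[OF L])
  thus ?case by blast
next
  case (TMul s t)
  then obtain p q p' q' where r: "represents p q s" "represents p' q' t" by auto
  have eq: "a * b * (c * d) = (a * c) * (b * d)" for a b c d :: 'a by (simp add: algebra_simps)
  have "represents (p * p') (q * q') (TMul s t)"
    using r unfolding represents_def eval_at_mult eval_mult val.simps eq
    by (simp add: mpolys_closed[OF L])
  thus ?case by blast
qed

text \<open>The truth value \<open>b\<close> does not depend on \<open>v\<close>: it is constant on
  the part of the hypersurface \<open>f = 0\<close> where \<open>g\<close> and all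
  \<open>D k\<close> are nonzero.\<close>

definition decides :: "'a mpoly \<Rightarrow> 'a mpoly \<Rightarrow> bool \<Rightarrow> 'a qf_formula \<Rightarrow> bool" where
  "decides f g b \<phi> \<longleftrightarrow> g \<in> mpolys L V \<and> eval_hom h w g \<noteq> 0 \<and>
     (\<forall>v. eval_at v f = 0 \<longrightarrow> eval_at v g \<noteq> 0 \<longrightarrow> (\<forall>k<n. eval_at v (D k) \<noteq> 0) \<longrightarrow>
       (sat (specialise v) \<phi> \<longleftrightarrow> b))"

text \<open>With denominators cleared, an equation reads \<open>?P = 0\<close>. If \<open>?P\<close>
  vanishes at \<open>w\<close>, then \<open>f\<close> divides some \<open>g * ?P\<close>, so
  \<open>?P\<close> vanishes on \<open>f = 0 \<noteq> g\<close>; otherwise \<open>?P\<close> itself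
  is taken for \<open>g\<close>. For conjunctions and disjunctions the two polynomials are
  multiplied.\<close>

lemma formula_decided:
  assumes f: "\<And>P. P \<in> mpolys L V \<Longrightarrow> eval_hom h w P = 0 \<Longrightarrow>
      \<exists>g\<in>mpolys L V. eval_hom h w g \<noteq> 0 \<and> f dvd g * P"
    and "params \<phi> \<subseteq> L" "vars \<phi> \<subseteq> {..n}"
  shows "\<exists>g b. decides f g b \<phi>"
  using assms(2,3)
proof (induction \<phi>)
  case (FEq s t)
  then obtain p q p' q' where s: "represents p q s" and t: "represents p' q' t"
    using term_fraction[of s] term_fraction[of t] by auto
  let ?P = "p * q' - p' * q"
  have P: "?P \<in> mpolys L V" using s t by (auto simp: represents_def intro!: mpolys_closed L)
  have eq: "val (specialise v) s = val (specialise v) t \<longleftrightarrow> eval_at v ?P = 0"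
    if "\<forall>k<n. eval_at v (D k) \<noteq> 0" for v
  proof -
    have *: "eval_at v p = val (specialise v) s * eval_at v q" "eval_at v q \<noteq> 0"
      "eval_at v p' = val (specialise v) t * eval_at v q'" "eval_at v q' \<noteq> 0"
      using s t that by (simp_all add: represents_def)
    have "eval_at v ?P = (val (specialise v) s - val (specialise v) t) * eval_at v q * eval_at v q'"
      by (simp add: eval_at_diff eval_at_mult * algebra_simps)
    thus ?thesis using * by simp
  qed
  show ?case
  proof (cases "eval_hom h w ?P = 0")
    case True
    then obtain g r where g: "g \<in> mpolys L V" "eval_hom h w g \<noteq> 0" "g * ?P = f * r"
      using f[OF P] by (auto simp: dvd_def)
    have "eval_at v ?P = 0" if "eval_at v f = 0" "eval_at v g \<noteq> 0" for v
    proof -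
      have "eval_at v g * eval_at v ?P = eval_at v (g * ?P)" by (simp only: eval_at_mult)
      also have "\<dots> = 0" unfolding g(3) eval_at_mult that by simp
      finally show ?thesis using that by simp
    qed
    hence "decides f g True (FEq s t)"
      using eq g(1,2) unfolding decides_def sat.simps by blast
    thus ?thesis by blast
  next
    case False
    hence "decides f ?P False (FEq s t)"
      using eq P unfolding decides_def sat.simps by blast
    thus ?thesis by blast
  qed
next
  case (FNot \<phi>)
  then obtain g b where "decides f g b \<phi>" by auto
  hence "decides f g (\<not> b) (FNot \<phi>)" unfolding decides_def sat.simps by blast
  thus ?case by blast
next
  case (FAnd \<phi> \<psi>)
  then obtain g b g' b' where g: "decides f g b \<phi>" "decides f g' b' \<psi>" by fastforce
  have "g * g' \<in> mpolys L V" "eval_hom h w (g * g') \<noteq> 0"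
    using g by (auto simp: decides_def eval_mult intro: mpolys_closed L)
  hence "decides f (g * g') (b \<and> b') (FAnd \<phi> \<psi>)"
    using g unfolding decides_def sat.simps eval_at_mult mult_eq_0_iff by blast
  thus ?case by blast
next
  case (FOr \<phi> \<psi>)
  then obtain g b g' b' where g: "decides f g b \<phi>" "decides f g' b' \<psi>" by fastforce
  have "g * g' \<in> mpolys L V" "eval_hom h w (g * g') \<noteq> 0"
    using g by (auto simp: decides_def eval_mult intro: mpolys_closed L)
  hence "decides f (g * g') (b \<or> b') (FOr \<phi> \<psi>)"
    using g unfolding decides_def sat.simps eval_at_mult mult_eq_0_iff by blast
  thus ?case by blast
qed

end

section \<open>A shortest tuple that generates the witnesses\<close>

text \<open>Two coordinates outside a maximal independent set could be replaced by one primitive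
  element, against minimality. So at most one coordinate is dependent, and it becomes the variable
  \<open>z\<close>.\<close>

lemma generating_tuple_exists:
  fixes L :: "'a::{alg_closed_field, field_char_0} set" and x :: "'i set \<Rightarrow> 'a" and y :: "nat \<Rightarrow> 'i set \<Rightarrow> 'a"
  assumes L: "subfield_set L" and x: "\<And>i. x i \<in> L" and y: "\<And>k i. k < n \<Longrightarrow> y k i \<in> L"
    and trans: "\<And>P. P \<in> mpolys UNIV {0} \<Longrightarrow> eval_hom ultra_const (\<lambda>_. ultra_class x) P = 0 \<Longrightarrow> P = 0"
  shows "\<exists>e W z. W 0 = x \<and> (\<forall>k i. W k i \<in> L) \<and> z \<in> {..e} \<and>
    (\<forall>P\<in>mpolys UNIV ({..e} - {z}). eval_hom ultra_const (\<lambda>k. ultra_class (W k)) P = 0 \<longrightarrow> P = 0) \<and>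
    (\<exists>P\<in>mpolys UNIV {..e}. P \<noteq> 0 \<and> eval_hom ultra_const (\<lambda>k. ultra_class (W k)) P = 0) \<and>
    (\<forall>k<n. ultra_class (y k) \<in> field_gen (ultra_const ` L \<union> (\<lambda>k. ultra_class (W k)) ` {..e}))"
proof -
  define Lst where "Lst = {ultra_class s |s :: 'i set \<Rightarrow> 'a. \<forall>i. s i \<in> L}"
  let ?C = "ultra_const ` L :: ('i, 'a) ultrapower set"
  let ?x = "ultra_class x"
  \<comment> \<open>\<open>?x\<close> is adjoined separately, so only the other generators are
    counted.\<close>
  define gens where "gens G \<longleftrightarrow> finite G \<and> G \<subseteq> Lst \<and>
      (\<forall>k<n. ultra_class (y k) \<in> field_gen (?C \<union> insert ?x G))" for G
  have "gens ((\<lambda>k. ultra_class (y k)) ` {..<n})"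
    using y unfolding gens_def Lst_def by (auto intro: field_gen.base)
  then obtain G where G: "gens G" and Gmin: "\<And>G'. gens G' \<Longrightarrow> card G \<le> card G'"
    using ex_has_least_nat[of gens _ card] by blast
  have finG: "finite G" and GL: "G \<subseteq> Lst" using G by (auto simp: gens_def)
  define m where "m = card G"
  obtain g where g: "bij_betw g {1..m} G" unfolding m_def using ex_bij_betw_nat_finite_1[OF finG] by blast
  \<comment> \<open>Coordinate \<open>0\<close> is the point and \<open>1\<close> to
    \<open>m\<close> enumerate \<open>G\<close>. The default \<open>0\<close> at
    \<open>Suc m\<close> supplies a dependent coordinate if there is no other.\<close>
  define w where "w k = (if k = 0 then ?x else if k \<le> m then g k else 0)" for k
  have w0: "w 0 = ?x" by (simp add: w_def)
  have "bij_betw w {1..m} G" using g bij_betw_cong[of "{1..m}" w g G] by (simp add: w_def)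
  hence wG: "w ` {1..m} = G" and winj: "inj_on w {1..m}" by (auto simp: bij_betw_def)
  have wm1: "w (Suc m) = 0" by (simp add: w_def)
  have "\<exists>s. w k = ultra_class s \<and> (\<forall>i. s i \<in> L) \<and> (k = 0 \<longrightarrow> s = x)" for k
  proof (cases "1 \<le> k \<and> k \<le> m")
    case True
    hence "w k \<in> Lst" using wG GL by auto
    thus ?thesis using True unfolding Lst_def by auto
  next
    case False
    show ?thesis
    proof (cases "k = 0")
      case True
      thus ?thesis using x w0 by auto
    next
      case k: False
      hence "w k = ultra_class (\<lambda>i. 0)" using False by (auto simp: w_def ultra_class_hom)
      thus ?thesis using k subfield_setD(1)[OF L] by (intro exI[of _ "\<lambda>i. 0"]) auto
    qed
  qed
  then obtain W where W: "\<And>k. w k = ultra_class (W k)" "\<And>k i. W k i \<in> L" "W 0 = x" by metis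
  have w_eq: "(\<lambda>k. ultra_class (W k)) = w" using W(1) by auto
  interpret ring_hom_map "ultra_const :: 'a \<Rightarrow> ('i, 'a) ultrapower" by (rule ring_hom_map_ultra_const)
  let ?E = "eval_hom ultra_const w"
  define indep where "indep I \<longleftrightarrow> (\<forall>P\<in>mpolys UNIV (insert 0 I). ?E P = 0 \<longrightarrow> P = 0)" for I
  have "indep {}" unfolding indep_def
  proof (intro ballI impI)
    fix P :: "'a mpoly" assume P: "P \<in> mpolys UNIV {0}" "?E P = 0"
    have "?E P = eval_hom ultra_const (\<lambda>_. ?x) P" using P(1) by (rule eval_hom_cong) (auto simp: w0)
    thus "P = 0" using P trans by auto
  qed
  hence "{I. I \<subseteq> {1..m} \<and> indep I} \<noteq> {}" by blast
  then obtain I where I: "I \<subseteq> {1..m}" "indep I"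
    and Imax: "\<And>I'. I' \<subseteq> {1..m} \<Longrightarrow> indep I' \<Longrightarrow> I \<subseteq> I' \<Longrightarrow> I = I'"
    using finite_has_maximal[of "{I. I \<subseteq> {1..m} \<and> indep I}"] by auto
  \<comment> \<open>The descent to coefficients in \<open>L\<close> matters, since the constants
    adjoined in \<open>?K\<close> come from \<open>L\<close>.\<close>
  have relation: "\<exists>P\<in>mpolys L (insert 0 (insert j I)). P \<noteq> 0 \<and> ?E P = 0" if "j \<in> {1..m} - I" for j
  proof -
    have "\<not> indep (insert j I)" using Imax[of "insert j I"] I that by auto
    then obtain P where "P \<in> mpolys UNIV (insert 0 (insert j I))" "P \<noteq> 0" "?E P = 0"
      by (auto simp: indep_def)
    thus ?thesis using descent_to_subfield[OF L, of P "insert 0 (insert j I)" W] W(2) w_eq by auto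
  qed
  let ?K = "field_gen (?C \<union> w ` insert 0 I)"
  have algebraic: "algebraic_over ?K (w j)" if j: "j \<in> {1..m} - I" for j
  proof -
    obtain P where P: "P \<in> mpolys L (insert 0 (insert j I))" "P \<noteq> 0" "?E P = 0"
      using relation[OF j] by blast
    have V: "insert 0 (insert j I) - {j} = insert 0 I" using j by auto
    define p where "p = map_poly ?E (split_var j P)"
    have cs: "coeff (split_var j P) k \<in> mpolys L (insert 0 I)" for k
      using coeff_split_var[OF L P(1), of j k] unfolding V .
    have cp: "coeff p k = ?E (coeff (split_var j P) k)" for k
      by (simp add: p_def coeff_map_poly)
    have "coeff p k \<in> ?K" for k
      unfolding cp by (rule eval_hom_in_subfield[OF subfield_set_field_gen cs]) (auto intro: field_gen.base)
    \<comment> \<open>A nonzero coefficient involves only independent coordinates, so its value is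
      nonzero.\<close>
    moreover have "p \<noteq> 0"
    proof -
      have "split_var j P \<noteq> 0" using poly_split_var[of j P] P(2) by auto
      then obtain k where k: "coeff (split_var j P) k \<noteq> 0" by (metis leading_coeff_0_iff)
      moreover have "coeff (split_var j P) k \<in> mpolys UNIV (insert 0 I)"
        using mpolys_mono[OF subset_refl subset_UNIV cs] .
      ultimately have "coeff p k \<noteq> 0" using I(2) unfolding indep_def cp by blast
      thus ?thesis by auto
    qed
    moreover have "poly p (w j) = 0"
      using eval_poly[of w "split_var j P" "mvar j"] P(3) by (simp add: p_def poly_split_var)
    ultimately show ?thesis unfolding algebraic_over_def by blast
  qed
  have le1: "a = b" if ab: "a \<in> {1..m} - I" "b \<in> {1..m} - I" for a b
  proof (rule ccontr)
    assume "a \<noteq> b"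
    obtain c where c: "\<forall>M. subfield_set M \<longrightarrow> ?K \<subseteq> M \<longrightarrow> w a + of_nat c * w b \<in> M \<longrightarrow> w b \<in> M"
      using primitive_element[OF subfield_set_field_gen algebraic[OF ab(1)] algebraic[OF ab(2)]] ..
    \<comment> \<open>Putting \<open>\<theta>\<close> in place of \<open>w a\<close> and
      \<open>w b\<close> makes \<open>G\<close> smaller, while the generated field still contains
      \<open>w b\<close> by the choice of \<open>c\<close>, and then \<open>w a\<close>.\<close>
    define \<theta> where "\<theta> = w a + of_nat c * w b"
    define G' where "G' = insert \<theta> (G - {w a, w b})"
    let ?M = "field_gen (?C \<union> insert ?x G')"
    note M = subfield_set_field_gen[of "?C \<union> insert ?x G'"]
    have wab: "w a \<in> G" "w b \<in> G" "w a \<noteq> w b"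
      using wG ab inj_onD[OF winj, of a b] \<open>a \<noteq> b\<close> by blast+
    have "\<theta> \<in> Lst" unfolding Lst_def
    proof (intro CollectI exI conjI allI)
      show "\<theta> = ultra_class (\<lambda>i. W a i + of_nat c * W b i)"
        by (simp add: \<theta>_def W(1) ultra_class_hom ultra_class_of_nat)
      show "W a i + of_nat c * W b i \<in> L" for i
        by (intro subfield_setD(3,4)[OF L] subfield_set_of_nat[OF L] W(2))
    qed
    moreover have "card G' < card G"
    proof -
      have "card (G - {w a, w b}) = card G - 2"
        using card_Diff_subset[of "{w a, w b}" G] wab by simp
      moreover have "card {w a, w b} \<le> card G" using wab finG by (intro card_mono) auto
      hence "2 \<le> card G" using wab by simp
      moreover have "card G' \<le> Suc (card (G - {w a, w b}))"
        unfolding G'_def by (simp add: card_insert_if finG)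
      ultimately show ?thesis by linarith
    qed
    moreover have wI: "w ` I \<subseteq> G - {w a, w b}"
    proof -
      have "w k \<in> G" "w k \<noteq> w a" "w k \<noteq> w b" if "k \<in> I" for k
      proof -
        have k: "k \<in> {1..m}" "k \<noteq> a" "k \<noteq> b" using that I(1) ab by auto
        thus "w k \<in> G" using wG by blast
        show "w k \<noteq> w a" using inj_on_eq_iff[OF winj k(1), of a] k(2) ab(1) by simp
        show "w k \<noteq> w b" using inj_on_eq_iff[OF winj k(1), of b] k(3) ab(2) by simp
      qed
      thus ?thesis by auto
    qed
    have base: "?C \<union> insert ?x G' \<subseteq> ?M" by (rule subsetI) (rule field_gen.base)
    have "?C \<union> w ` insert 0 I \<subseteq> ?C \<union> insert ?x G'"
      unfolding image_insert w0 G'_def using wI by blast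
    hence KM: "?K \<subseteq> ?M" using base by (intro field_gen_least[OF M]) blast
    have \<theta>M: "\<theta> \<in> ?M" using base unfolding G'_def by blast
    hence bM: "w b \<in> ?M" using c[rule_format, OF M KM] by (simp only: \<theta>_def)
    have "\<theta> - of_nat c * w b \<in> ?M"
      by (intro subfield_setD(4,7)[OF M] subfield_set_of_nat[OF M] \<theta>M bM)
    hence aM: "w a \<in> ?M" by (simp add: \<theta>_def)
    have "?C \<union> insert ?x (G - {w a, w b}) \<subseteq> ?M" using base unfolding G'_def by blast
    hence "?C \<union> insert ?x G \<subseteq> ?M" using aM bM by blast
    hence "field_gen (?C \<union> insert ?x G) \<subseteq> ?M" by (rule field_gen_least[OF M])
    ultimately have "gens G'" using G by (auto simp: gens_def G'_def)
    thus False using Gmin[of G'] \<open>card G' < card G\<close> by simp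
  qed
  have gen: "ultra_class (y k) \<in> field_gen (?C \<union> w ` {..e})" if "k < n" "m \<le> e" for k e
  proof -
    have "?C \<union> insert ?x G \<subseteq> ?C \<union> w ` {..e}"
      using that(2) w0[symmetric] unfolding wG[symmetric] by auto
    hence "field_gen (?C \<union> insert ?x G) \<subseteq> field_gen (?C \<union> w ` {..e})"
      by (intro field_gen_least subfield_set_field_gen) (auto intro: field_gen.base)
    thus ?thesis using G that(1) by (auto simp: gens_def)
  qed
  show ?thesis
  proof (cases "{1..m} - I = {}")
    case True
    \<comment> \<open>The vanishing ideal is zero, so the dummy coordinate \<open>w (Suc m) = 0\<close> is adjoined.\<close>
    have V: "{..Suc m} - {Suc m} = insert 0 I" using True I(1) by auto
    show ?thesis
    proof (intro exI[of _ "Suc m"] exI[of _ W] conjI, unfold w_eq V)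
      show "\<forall>P\<in>mpolys UNIV (insert 0 I). ?E P = 0 \<longrightarrow> P = 0" using I(2) by (simp add: indep_def)
      have "(mvar (Suc m) :: 'a mpoly) \<in> mpolys UNIV {..Suc m}" by (rule mpolys_closed(7)[OF subfield_set_UNIV]) simp
      moreover have "mvar (Suc m) \<noteq> (0 :: 'a mpoly)"
        unfolding mvar_def by (metis lookup_single_eq lookup_zero zero_neq_one)
      moreover have "?E (mvar (Suc m)) = 0" by (simp add: wm1)
      ultimately show "\<exists>P\<in>mpolys UNIV {..Suc m}. P \<noteq> 0 \<and> ?E P = 0" by blast
    qed (use gen W in auto)
  next
    case False
    then obtain j where j: "j \<in> {1..m} - I" by blast
    then obtain P where P: "P \<in> mpolys L (insert 0 (insert j I))" "P \<noteq> 0" "?E P = 0"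
      using relation by blast
    have "{1..m} - I = {j}" using j le1 by blast
    hence V: "{..m} - {j} = insert 0 I" using I(1) j by force
    show ?thesis
    proof (rule exI[of _ m], rule exI[of _ W], rule exI[of _ j], intro conjI, unfold w_eq V)
      show "\<forall>P\<in>mpolys UNIV (insert 0 I). ?E P = 0 \<longrightarrow> P = 0" using I(2) by (simp add: indep_def)
      have "P \<in> mpolys UNIV {..m}" using P(1) by (rule mpolys_mono[rotated 2]) (use I(1) j in auto)
      thus "\<exists>P\<in>mpolys UNIV {..m}. P \<noteq> 0 \<and> ?E P = 0" using P by blast
    qed (use gen W j in auto)
  qed
qed

section \<open>The contradiction at a generic point of \<open>A\<close>\<close>

theorem theorem1p4:
  fixes L A :: "rat alg_closure set"
  assumes "subfield L ring_of_type_algebra"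
    and "A \<subseteq> L"
    and "existentially_definable L A"
  shows "\<exists>\<beta>s :: rat alg_closure basic_formula list.
           (\<forall>\<beta> \<in> set \<beta>s. admissible L \<beta>) \<and>
           A = {x \<in> L. \<exists>\<beta> \<in> set \<beta>s. sat_basic L x \<beta>}"
proof (rule ccontr)
  assume no: "\<not> ?thesis"
  note L = subfield_imp_subfield_set[OF assms(1)]
  obtain n \<phi> where \<phi>: "params \<phi> \<subseteq> L" "vars \<phi> \<subseteq> {..n}"
    and A: "A = {x \<in> L. \<exists>y \<in> {..<n} \<rightarrow> L. sat (case_nat x y) \<phi>}"
    using assms(3) unfolding existentially_definable_def by blast
  define good where "good \<beta> \<longleftrightarrow> admissible L \<beta> \<and> {x \<in> L. sat_basic L x \<beta>} \<subseteq> A" for \<beta>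
  \<comment> \<open>If the good members of a finite set covered \<open>A\<close>, their disjunction
    would define \<open>A\<close>, contrary to \<open>no\<close>.\<close>
  have uncovered: "\<exists>a\<in>A. \<forall>\<beta>\<in>i. good \<beta> \<longrightarrow> \<not> sat_basic L a \<beta>" if "finite i" for i
  proof (rule ccontr)
    assume c: "\<not> ?thesis"
    obtain \<beta>s where \<beta>s: "set \<beta>s = {\<beta> \<in> i. good \<beta>}" using finite_list[of "{\<beta> \<in> i. good \<beta>}"] \<open>finite i\<close> by auto
    have "A = {x \<in> L. \<exists>\<beta> \<in> set \<beta>s. sat_basic L x \<beta>}"
      using c assms(2) unfolding \<beta>s good_def by blast
    moreover have "\<forall>\<beta> \<in> set \<beta>s. admissible L \<beta>" by (simp add: \<beta>s good_def)
    ultimately show False using no by blast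
  qed
  \<comment> \<open>At infinite \<open>i\<close>, which the ultrafilter ignores, the value is an
    arbitrary point of \<open>A\<close>; \<open>uncovered\<close> for the empty set provides
    one.\<close>
  have "\<exists>a. a \<in> A \<and> (finite i \<longrightarrow> (\<forall>\<beta>\<in>i. good \<beta> \<longrightarrow> \<not> sat_basic L a \<beta>))" for i
    using uncovered[of i] uncovered[of "{}"] by (cases "finite i") auto
  then obtain x where xA: "\<And>i. x i \<in> A" and x: "\<And>i \<beta>. finite i \<Longrightarrow> \<beta> \<in> i \<Longrightarrow> good \<beta> \<Longrightarrow> \<not> sat_basic L (x i) \<beta>"
    by metis
  have xL: "x i \<in> L" for i using xA assms(2) by blast
  have avoid: "eventually (\<lambda>i. \<not> sat_basic L (x i) \<beta>) ultra" if "good \<beta>" for \<beta>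
    using eventually_ultra_member[of \<beta>] by (rule eventually_mono) (use x that in blast)
  have "\<exists>y. y \<in> {..<n} \<rightarrow> L \<and> sat (case_nat (x i) y) \<phi>" for i using xA[of i] A by blast
  then obtain y where y: "\<And>i. y i \<in> {..<n} \<rightarrow> L" "\<And>i. sat (case_nat (x i) (y i)) \<phi>" by metis
  \<comment> \<open>A nonzero \<open>P\<close> has finitely many roots, so \<open>x\<close> would be
    almost everywhere one constant \<open>c\<close> in \<open>A\<close>, and the good formula
    \<open>Point c\<close> would not be avoided.\<close>
  have trans: "P = 0" if P: "P \<in> mpolys UNIV {0}" "eval_hom ultra_const (\<lambda>_. ultra_class x) P = 0" for P
  proof (rule ccontr)
    assume "P \<noteq> 0"
    have "eventually (\<lambda>i. x i \<in> {c. eval_at (\<lambda>_. c) P = 0}) ultra"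
      using P(2) eval_ultrapower[of "\<lambda>_. x" P] by (simp add: ultra_class_eq_0)
    then obtain c where c: "eventually (\<lambda>i. x i = c) ultra"
      using ultra_finite_image[OF finite_zeros_univariate[OF P(1) \<open>P \<noteq> 0\<close>]] by blast
    then obtain i where "x i = c" using eventually_happens[OF c] ultra(2) by blast
    hence "good (Point c)" using xA[of i] xL[of i] by (auto simp: good_def)
    hence "eventually (\<lambda>i. x i \<noteq> c) ultra" using avoid[of "Point c"] by simp
    thus False using c not_eventually_ultra by blast
  qed
  have yL: "y i k \<in> L" if "k < n" for k i using y(1)[of i] that by auto
  have "\<exists>e W z. W 0 = x \<and> (\<forall>k i. W k i \<in> L) \<and> z \<in> {..e} \<and>
    (\<forall>P\<in>mpolys UNIV ({..e} - {z}). eval_hom ultra_const (\<lambda>k. ultra_class (W k)) P = 0 \<longrightarrow> P = 0) \<and>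
    (\<exists>P\<in>mpolys UNIV {..e}. P \<noteq> 0 \<and> eval_hom ultra_const (\<lambda>k. ultra_class (W k)) P = 0) \<and>
    (\<forall>k<n. ultra_class (\<lambda>i. y i k) \<in> field_gen (ultra_const ` L \<union> (\<lambda>k. ultra_class (W k)) ` {..e}))"
    by (rule generating_tuple_exists[OF L xL]) (erule yL, erule trans, assumption)
  then obtain e W z P0 where W: "W 0 = x" "\<And>k i. W k i \<in> L" and z: "z \<in> {..e}"
    and indep: "\<And>P. P \<in> mpolys UNIV ({..e} - {z}) \<Longrightarrow>
      eval_hom ultra_const (\<lambda>k. ultra_class (W k)) P = 0 \<Longrightarrow> P = 0"
    and P0: "P0 \<in> mpolys UNIV {..e}" "P0 \<noteq> 0" "eval_hom ultra_const (\<lambda>k. ultra_class (W k)) P0 = 0"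
    and gen: "\<And>k. k < n \<Longrightarrow> ultra_class (\<lambda>i. y i k) \<in>
      field_gen (ultra_const ` L \<union> (\<lambda>k. ultra_class (W k)) ` {..e})"
    by blast
  let ?w = "\<lambda>k. ultra_class (W k)"
  let ?E = "eval_hom ultra_const ?w"
  have hom: "ring_hom_map (ultra_const :: _ \<Rightarrow> (rat alg_closure basic_formula, _) ultrapower)"
    by (rule ring_hom_map_ultra_const)
  have "\<exists>p q. p \<in> mpolys L {..e} \<and> q \<in> mpolys L {..e} \<and> ?E q \<noteq> 0 \<and>
      ultra_class (\<lambda>i. y i k) * ?E q = ?E p" if "k < n" for k
    using field_gen_fraction[OF hom L gen[OF that]] by blast
  then obtain N D where frac: "\<And>k. k < n \<Longrightarrow> N k \<in> mpolys L {..e}" "\<And>k. k < n \<Longrightarrow> D k \<in> mpolys L {..e}"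
    "\<And>k. k < n \<Longrightarrow> ?E (D k) \<noteq> 0" "\<And>k. k < n \<Longrightarrow> ultra_class (\<lambda>i. y i k) * ?E (D k) = ?E (N k)"
    by metis
  interpret generic_point ultra_const ?w L "{..e}" N D n
    by (rule generic_point.intro) (use hom L frac in auto)
  obtain f where f: "f \<in> mpolys L {..e}" "f \<noteq> 0" "?E f = 0"
    and fac: "\<And>a b. a \<in> mpolys UNIV {..e} \<Longrightarrow> b \<in> mpolys UNIV {..e} \<Longrightarrow> f = a * b \<Longrightarrow>
        wdeg total_exponent a = 0 \<or> wdeg total_exponent b = 0"
    and gen_f: "\<And>P. P \<in> mpolys L {..e} \<Longrightarrow> ?E P = 0 \<Longrightarrow> \<exists>g\<in>mpolys L {..e}. ?E g \<noteq> 0 \<and> f dvd g * P"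
    using generic_hypersurface[OF hom L z descent_to_subfield[OF L _ _ _ W(2)] indep P0] by blast
  obtain g b where dec: "decides f g b \<phi>" using formula_decided[OF gen_f \<phi>] by blast
  have g: "g \<in> mpolys L {..e}" "?E g \<noteq> 0" and b: "\<And>v. eval_at v f = 0 \<Longrightarrow>
      eval_at v g \<noteq> 0 \<Longrightarrow> \<forall>k<n. eval_at v (D k) \<noteq> 0 \<Longrightarrow> sat (specialise v) \<phi> \<longleftrightarrow> b"
    using dec unfolding decides_def by blast+
  \<comment> \<open>The factors \<open>D k\<close> ensure that all fractions
    \<open>N k / D k\<close> are defined where \<open>G\<close> is nonzero.\<close>
  define G where "G = g * (\<Prod>k<n. D k)"
  have prodD: "eval_at v (\<Prod>k<n. D k) = (\<Prod>k<n. eval_at v (D k))"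
    "?E (\<Prod>k<n. D k) = (\<Prod>k<n. ?E (D k))" for v
    by (induction n) (auto simp: eval_at_mult eval_mult)
  have "(\<Prod>k\<in>S. D k) \<in> mpolys L {..e}" if "S \<subseteq> {..<n}" for S
    using finite_subset[OF that finite_lessThan] that
    by (induction S rule: finite_induct) (auto intro!: mpolys_closed L frac)
  hence GL: "G \<in> mpolys L {..e}" unfolding G_def using g by (intro mpolys_closed L) auto
  have "(\<Prod>k<n. ?E (D k)) \<noteq> 0" unfolding prod_zero_iff[OF finite_lessThan] using frac(3) by blast
  hence EG: "?E G \<noteq> 0" using g(2) by (simp add: G_def eval_mult prodD)
  have G0: "eval_at v G \<noteq> 0 \<longleftrightarrow> eval_at v g \<noteq> 0 \<and> (\<forall>k<n. eval_at v (D k) \<noteq> 0)" for v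
    by (auto simp: G_def eval_at_mult prodD)
  let ?v = "\<lambda>i k. W k i"
  have ev_f: "eventually (\<lambda>i. eval_at (?v i) f = 0) ultra"
    using f(3) by (simp add: eval_ultrapower ultra_class_eq_0)
  have ev_G: "eventually (\<lambda>i. eval_at (?v i) G \<noteq> 0) ultra"
    using EG by (simp add: eval_ultrapower ultra_class_eq_0 not_eventually_ultra)
  have "eventually (\<lambda>i. y i k * eval_at (?v i) (D k) = eval_at (?v i) (N k)) ultra" if "k < n" for k
    using frac(4)[OF that] by (simp only: eval_ultrapower ultra_class_hom(4)[symmetric] ultra_class_eq_iff)
  hence "eventually (\<lambda>i. \<forall>k\<in>{..<n}. y i k * eval_at (?v i) (D k) = eval_at (?v i) (N k)) ultra"
    by (intro eventually_ball_finite) auto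
  \<comment> \<open>At almost all indices \<open>W\<close> lies on \<open>f = 0 \<noteq> G\<close>
    and specialises to the witnesses \<open>y i\<close>, for which \<open>\<phi>\<close> holds; so
    the constant truth value is true.\<close>
  hence "eventually (\<lambda>i. b) (ultra :: rat alg_closure basic_formula set filter)" using ev_f ev_G
  proof eventually_elim
    case (elim i)
    have D: "eval_at (?v i) (D k) \<noteq> 0" if "k < n" for k using elim(3) G0 that by blast
    have "case_nat (x i) (y i) k = specialise (?v i) k" if "k \<in> vars \<phi>" for k
    proof (cases k)
      case 0
      thus ?thesis by (simp add: W(1))
    next
      case (Suc l)
      hence "l < n" using that \<phi>(2) by auto
      hence "y i l * eval_at (?v i) (D l) = eval_at (?v i) (N l)" using elim(1) by blast
      hence "y i l = eval_at (?v i) (N l) / eval_at (?v i) (D l)"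
        using nonzero_eq_divide_eq[OF D[OF \<open>l < n\<close>]] by blast
      thus ?thesis by (simp add: Suc)
    qed
    hence "sat (specialise (?v i)) \<phi>"
      using sat_cong[of \<phi> "case_nat (x i) (y i)" "specialise (?v i)"] y(2)[of i] by blast
    thus b using b[OF elim(2)] elim(3) G0 by blast
  qed
  from eventually_happens'[OF ultra(2) this] have b by blast
  hence b: "sat (specialise v) \<phi>" if "eval_at v f = 0" "eval_at v G \<noteq> 0" for v
    using b[of v] that G0 by blast
  have "good (Hypersurface e f G)" unfolding good_def
  proof (intro conjI subsetI)
    \<comment> \<open>Every multiple of \<open>f\<close> vanishes at the generic point, but
      \<open>1\<close> and \<open>G\<close> do not, so \<open>f\<close> divides neither of them even
      over the full field.\<close>
    have "?E (f * q) = 0" for q by (simp add: eval_mult f(3))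
    hence dvd0: "?E p = 0" if "f dvd p" for p using that by (auto simp: dvd_def)
    have nd: "\<not> f dvd 1" "\<not> f dvd G" using EG dvd0[of 1] dvd0[of G] by auto
    have "absolutely_irreducible e f"
      by (rule absolutely_irreducibleI[OF f(2) mpolys_mono[OF subset_refl subset_UNIV f(1)] nd(1)]) (rule fac)
    thus "admissible L (Hypersurface e f G)"
      using f GL nd by (auto simp: carrier_mpoly_ring factor_def mpoly_ring_simps)
  next
    fix a assume "a \<in> {x \<in> L. sat_basic L x (Hypersurface e f G)}"
    then obtain u where u: "a \<in> L" "u \<in> {..<e} \<rightarrow> L"
      "eval_at (case_nat a u) f = 0" "eval_at (case_nat a u) G \<noteq> 0"
      by (auto simp: eval_mpoly_eq)
    let ?u = "case_nat a u"
    have uL: "?u k \<in> L" if "k \<in> {..e}" for k using that u by (cases k) auto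
    have "eval_at ?u P \<in> L" if "P \<in> mpolys L {..e}" for P
      using that uL by (intro eval_hom_in_subfield[OF L]) auto
    \<comment> \<open>The fractions have coefficients and arguments in \<open>L\<close>, so they are
      witnesses in \<open>L\<close> for \<open>a\<close>.\<close>
    hence "(\<lambda>k. eval_at ?u (N k) / eval_at ?u (D k)) \<in> {..<n} \<rightarrow> L"
      using frac by (auto intro: subfield_setD(8)[OF L])
    moreover have "sat (case_nat a (\<lambda>k. eval_at ?u (N k) / eval_at ?u (D k))) \<phi>"
      using b[of ?u] u by simp
    ultimately show "a \<in> A" using u(1) A by blast
  qed
  hence "eventually (\<lambda>i. \<not> sat_basic L (x i) (Hypersurface e f G)) ultra" by (rule avoid)
  hence "eventually (\<lambda>i. False) (ultra :: rat alg_closure basic_formula set filter)" using ev_f ev_G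
  proof eventually_elim
    case (elim i)
    \<comment> \<open>The coordinates of \<open>W\<close> from index \<open>1\<close> on serve as
      \<open>Y\<close>-values in \<open>L\<close>.\<close>
    have "case_nat (x i) (\<lambda>k. W (Suc k) i) = ?v i" using W(1) by (auto simp: fun_eq_iff split: nat.splits)
    hence "sat_basic L (x i) (Hypersurface e f G)"
      using elim W(2) by (auto simp: eval_mpoly_eq intro!: bexI[of _ "\<lambda>k. W (Suc k) i"])
    thus False using elim by blast
  qed
  thus False by (simp add: eventually_False ultra(2))
qed

end
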